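(* Let $\mathcal{T}=(T_t)_{t\in\mathbb{R}}$ be a measurable, measure-preserving flow on a probability standard Borel space $(X,\mathcal{B},\mu)$ which is free, ergodic and has Ratner's property. Then its essential centralizer $EC(\mathcal{T}):=C(\mathcal{T})/\{T_t:\ t\in\mathbb{R}\}$ is discrete and countable.
   Context: ${\rm Aut}(X,\mathcal{B},\mu)$ is the group of measure-preserving automorphisms, viewed as unitary operators $Sf=f\circ S$ on $L^2(X,\mathcal{B},\mu)$ and equipped with the strong operator topology (a Polish group). A flow is measurable if $(x,t)\mapsto T_tx$ is measurable. The centralizer is $C(\mathcal{T})=\{S\in{\rm Aut}(X,\mathcal{B},\mu): ST_t=T_tS \text{ for all } t\}$, with the induced topology; $EC(\mathcal{T})$ carries the quotient topology. $R(t_0,P)$-property: let $(X,d)$ be a $\sigma$-compact metric space, $\mu$ a Borel probability measure and $(T_t)$ an ergodic flow. Fix a finite set $P\subset\mathbb{R}$ with $0\notin P$ and $t_0\in\mathbb{R}\setminus\{0\}$. $(T_t)$ has the $R(t_0,P)$-property if for every $\varepsilon>0$ and $N\in\mathbb{N}$ there exist $\kappa=\kappa(\varepsilon)>0$, $\delta=\delta(\varepsilon,N)>0$ and a set $Z=Z(\varepsilon,N)\subset X$ with $\mu(Z)>1-\varepsilon$ such that for all $x,y\in Z$ with $x$ not in the $(T_t)$-orbit of $y$ and $d(x,y)<\delta$ there exist $M,L\geq N$ with $L/M\geq\kappa$ and $p\in P$ such that $\frac1L\left|\{n\in[M,M+L]\cap\mathbb{Z}: d(T_{nt_0}x,T_{nt_0+p}y)<\varepsilon\}\right|>1-\varepsilon$.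 The flow has Ratner's property (with set $P$) if the set of $s\in\mathbb{R}$ for which it has the $R(s,P)$-property is uncountable. A flow on an abstract probability standard Borel space has Ratner's property if it is measure-theoretically isomorphic to a flow on a $\sigma$-compact metric space with Ratner's property (this does not depend on the choice of such a metric model). *)

theory Defs
  imports "HOL-Probability.Probability"
begin

definition measure_preserving :: "'a measure \<Rightarrow> 'b measure \<Rightarrow> ('a \<Rightarrow> 'b) set" where
  "measure_preserving M N = {f \<in> measurable M N. distr M N f = N}"

definition measurable_flow :: "'a measure \<Rightarrow> (real \<Rightarrow> 'a \<Rightarrow> 'a) \<Rightarrow> bool" where
  "measurable_flow M T \<longleftrightarrow>
     (\<forall>x. T 0 x = x) \<and> (\<forall>s t x. T (s + t) x = T s (T t x)) \<and>
     (\<lambda>(x, t). T t x) \<in> measurable (M \<Otimes>\<^sub>M lborel) M \<and>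
     (\<forall>t. T t \<in> measure_preserving M M)"

definition free_flow :: "'a measure \<Rightarrow> (real \<Rightarrow> 'a \<Rightarrow> 'a) \<Rightarrow> bool" where
  "free_flow M T \<longleftrightarrow> (AE x in M. \<forall>t. t \<noteq> 0 \<longrightarrow> T t x \<noteq> x)"

definition ergodic_flow :: "'a measure \<Rightarrow> (real \<Rightarrow> 'a \<Rightarrow> 'a) \<Rightarrow> bool" where
  "ergodic_flow M T \<longleftrightarrow>
     (\<forall>A \<in> sets M. (\<forall>t. T t -` A \<inter> space M = A) \<longrightarrow> measure M A = 0 \<or> measure M A = 1)"

text \<open>Representatives of elements of Aut(X): measure-preserving maps invertible mod 0.
  Two representatives equal a.e. give the same unitary operator \<open>f \<mapsto> f \<circ> S\<close>.\<close>
definition aut :: "'a measure \<Rightarrow> ('a \<Rightarrow> 'a) set" where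
  "aut M = {S \<in> measure_preserving M M. \<exists>S' \<in> measure_preserving M M.
              (AE x in M. S' (S x) = x) \<and> (AE x in M. S (S' x) = x)}"

definition L2fun :: "'a measure \<Rightarrow> ('a \<Rightarrow> complex) set" where
  "L2fun M = {f \<in> borel_measurable M. (\<integral>\<^sup>+ x. ennreal ((cmod (f x))\<^sup>2) \<partial>M) < \<infinity>}"

text \<open>Strong operator topology on Aut(X) (via the unitary operators \<open>S f = f \<circ> S\<close>):
  generated by the sets \<open>{S'. \<parallel>S' f - S f\<parallel>\<^sub>2\<^sup>2 < r}\<close>.\<close>
definition sot :: "'a measure \<Rightarrow> ('a \<Rightarrow> 'a) topology" where
  "sot M = topology_generated_by
     {{S' \<in> aut M. (\<integral>\<^sup>+ x. ennreal ((cmod (f (S' x) - f (S x)))\<^sup>2) \<partial>M) < ennreal r}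
        | f S r. f \<in> L2fun M \<and> S \<in> aut M \<and> r > 0}"

definition centralizer :: "'a measure \<Rightarrow> (real \<Rightarrow> 'a \<Rightarrow> 'a) \<Rightarrow> ('a \<Rightarrow> 'a) set" where
  "centralizer M T = {S \<in> aut M. \<forall>t. AE x in M. S (T t x) = T t (S x)}"

text \<open>The coset of S modulo the subgroup {T_t}, as a set of representatives in C(T).\<close>
definition ec_class :: "'a measure \<Rightarrow> (real \<Rightarrow> 'a \<Rightarrow> 'a) \<Rightarrow> ('a \<Rightarrow> 'a) \<Rightarrow> ('a \<Rightarrow> 'a) set" where
  "ec_class M T S = {S' \<in> centralizer M T. \<exists>t. AE x in M. S' x = T t (S x)}"

definition EC :: "'a measure \<Rightarrow> (real \<Rightarrow> 'a \<Rightarrow> 'a) \<Rightarrow> ('a \<Rightarrow> 'a) set set" where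
  "EC M T = ec_class M T ` centralizer M T"

definition R_property :: "'b::metric_space measure \<Rightarrow> (real \<Rightarrow> 'b \<Rightarrow> 'b) \<Rightarrow> real \<Rightarrow> real set \<Rightarrow> bool" where
  "R_property N S t0 P \<longleftrightarrow>
    (\<forall>\<epsilon>>0. \<exists>\<kappa>>0. \<forall>Nn::nat. \<exists>\<delta>>0. \<exists>Z \<in> sets N. measure N Z > 1 - \<epsilon> \<and>
       (\<forall>x\<in>Z. \<forall>y\<in>Z. (\<not> (\<exists>t. x = S t y)) \<and> dist x y < \<delta> \<longrightarrow>
          (\<exists>M L :: nat. M \<ge> Nn \<and> L \<ge> Nn \<and> real L / real M \<ge> \<kappa> \<and>
             (\<exists>p\<in>P. real (card {n \<in> {M..M+L}. dist (S (real n * t0) x) (S (real n * t0 + p) y) < \<epsilon>})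
                        / real L > 1 - \<epsilon>))))"

definition metric_model :: "'b::metric_space measure \<Rightarrow> (real \<Rightarrow> 'b \<Rightarrow> 'b) \<Rightarrow> bool" where
  "metric_model N S \<longleftrightarrow>
     (\<exists>K :: nat \<Rightarrow> 'b set. (\<forall>i. compact (K i)) \<and> (\<Union>i. K i) = UNIV) \<and>
     prob_space N \<and> sets N = sets borel \<and> measurable_flow N S \<and> ergodic_flow N S"

definition ratner_metric :: "'b::metric_space measure \<Rightarrow> (real \<Rightarrow> 'b \<Rightarrow> 'b) \<Rightarrow> bool" where
  "ratner_metric N S \<longleftrightarrow>
     metric_model N S \<and>
     (\<exists>P. finite P \<and> 0 \<notin> P \<and> uncountable {s. s \<noteq> 0 \<and> R_property N S s P})"

definition flow_iso :: "'a measure \<Rightarrow> (real \<Rightarrow> 'a \<Rightarrow> 'a) \<Rightarrow> 'b measure \<Rightarrow> (real \<Rightarrow> 'b \<Rightarrow> 'b) \<Rightarrow> bool" where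
  "flow_iso M T N S \<longleftrightarrow>
     (\<exists>\<phi> \<psi>. \<phi> \<in> measure_preserving M N \<and> \<psi> \<in> measure_preserving N M \<and>
        (AE x in M. \<psi> (\<phi> x) = x) \<and> (AE y in N. \<phi> (\<psi> y) = y) \<and>
        (\<forall>t. AE x in M. \<phi> (T t x) = S t (\<phi> x)))"

end

theory Submission
  imports Defs
begin

text \<open>Let \<open>R\<close> commute with the flow and be close to the identity. If \<open>R x\<close> lies in the orbit of \<open>x\<close>
  for a set of \<open>x\<close> of positive measure, then \<open>R = T\<^sub>t\<close> for some \<open>t\<close> by ergodicity. Otherwise Ratner's
  property applies to the pairs \<open>(x, R x)\<close>: for most \<open>n\<close> in a window \<open>[m, m + l]\<close> with \<open>l / m \<ge> \<kappa>\<close> the point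
  \<open>z = T\<^bsub>n t0\<^esub> x\<close> is \<open>\<epsilon>\<close>-close to \<open>T\<^sub>p (R z)\<close>. By the maximal inequality \<open>T\<^sub>p (R z)\<close> is close to \<open>T\<^sub>p z\<close> for
  most of these \<open>n\<close>, so \<open>z\<close> is mostly close to \<open>T\<^sub>p z\<close>, which Birkhoff's theorem forbids since \<open>p \<noteq> 0\<close> and
  the flow is free. Hence the cosets of \<open>{T\<^sub>t}\<close> in the centralizer are uniformly separated, and the
  centralizer is separable.\<close>

section \<open>Maximal and pointwise ergodic theorems\<close>

text \<open>The order of quantifiers in \<open>R_property\<close> governs all constants:
  \<open>\<kappa>\<close> depends on \<open>\<epsilon>\<close> alone, so the tolerances
  \<open>\<tau>\<close> and \<open>c\<close> are fixed from \<open>\<kappa>\<close>, then a time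
  \<open>k\<close> after which Birkhoff averages vary by at most \<open>\<tau>\<close>, and only
  then \<open>\<delta>\<close> and \<open>Z\<close> for windows beyond \<open>k\<close>. The bound
  \<open>l / m \<ge> \<kappa>\<close> lets averages over initial segments control a window that
  starts late. A single map \<open>T t0\<close> of an ergodic flow need not be ergodic, so the
  averages of the near-return set need not tend to its measure. They have the right mean, and
  Markov's inequality makes them small for most points. The set of \<open>x\<close> with
  \<open>R x\<close> in the orbit of \<open>x\<close> is a projection along the time axis, with no
  evident measurability. Averaging along orbits produces coordinates continuous in time, and
  compactness of time intervals then reduces membership to countably many conditions. Commutation
  with the flow holds for each time off a null set depending on that time, so it is used at
  countably many times or through Fubini.\<close>

lemma measure_preserving_measurable: "f \<in> measure_preserving M N \<Longrightarrow> f \<in> measurable M N"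
  by (simp add: measure_preserving_def)

lemma AE_measure_preserving:
  assumes "f \<in> measure_preserving M N" "AE y in N. P y"
  shows "AE x in M. P (f x)"
  using AE_distrD[of f M N P] assms(2)
  by (metis (mono_tags, lifting) assms(1) measure_preserving_def mem_Collect_eq)

lemma measure_preserving_emeasure:
  assumes "f \<in> measure_preserving M N" "A \<in> sets N"
  shows "emeasure M (f -` A \<inter> space M) = emeasure N A"
  using assms emeasure_distr[of f M N A] by (simp add: measure_preserving_def)

lemma measure_preserving_measure:
  assumes "f \<in> measure_preserving M N" "A \<in> sets N"
  shows "measure M (f -` A \<inter> space M) = measure N A"
  using measure_preserving_emeasure[OF assms] by (simp add: measure_def)

lemma measure_preserving_comp:
  assumes "f \<in> measure_preserving M N" "g \<in> measure_preserving N K"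
  shows "g \<circ> f \<in> measure_preserving M K"
  using assms by (auto simp: measure_preserving_def distr_distr[symmetric])

lemma measure_preserving_funpow:
  assumes "U \<in> measure_preserving M M"
  shows "U ^^ n \<in> measure_preserving M M"
proof (induction n)
  case 0 then show ?case by (simp add: measure_preserving_def id_def distr_id2)
next
  case (Suc n)
  from measure_preserving_comp[OF this assms] show ?case by (simp add: o_def)
qed

lemma measure_preserving_integral:
  fixes f :: "'b \<Rightarrow> real"
  assumes "g \<in> measure_preserving M N" "f \<in> borel_measurable N"
  shows "(\<integral>x. f (g x) \<partial>M) = (\<integral>y. f y \<partial>N)"
  using assms integral_distr[of g M N f] by (simp add: measure_preserving_def)

lemma measure_preserving_integrable:
  fixes f :: "'b \<Rightarrow> real"
  assumes "g \<in> measure_preserving M N" "integrable N f"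
  shows "integrable M (\<lambda>x. f (g x))"
proof -
  have g: "g \<in> measurable M N" "distr M N g = N"
    using assms(1) by (simp_all add: measure_preserving_def)
  show ?thesis
    by (rule integrable_distr[OF g(1)]) (simp add: g(2) assms(2))
qed

text \<open>\<open>max_sum U g n x\<close> is the maximum over \<open>k \<le> n\<close> of the Birkhoff sums \<open>\<Sum>i<k. g (U\<^sup>i x)\<close>;
  the recursion makes the key inequality of Garsia's proof immediate.\<close>
primrec max_sum :: "('a \<Rightarrow> 'a) \<Rightarrow> ('a \<Rightarrow> real) \<Rightarrow> nat \<Rightarrow> 'a \<Rightarrow> real" where
  "max_sum U g 0 x = 0"
| "max_sum U g (Suc n) x = max 0 (g x + max_sum U g n (U x))"

lemma max_sum_nonneg: "0 \<le> max_sum U g n x"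
  by (cases n) auto

lemma max_sum_mono_Suc: "max_sum U g n x \<le> max_sum U g (Suc n) x"
proof (induction n arbitrary: x)
  case (Suc n)
  have "max_sum U g n (U x) \<le> max_sum U g (Suc n) (U x)" by (rule Suc)
  then show ?case by (simp only: max_sum.simps(2)[of U g _ x])
qed simp

lemma max_sum_mono: "m \<le> n \<Longrightarrow> max_sum U g m x \<le> max_sum U g n x"
  by (induction n rule: dec_induct) (auto intro: order_trans max_sum_mono_Suc simp del: max_sum.simps)

lemma birkhoff_sum_Suc:
  fixes g :: "'a \<Rightarrow> real"
  shows "(\<Sum>i<Suc n. g ((U ^^ i) x)) = g x + (\<Sum>i<n. g ((U ^^ i) (U x)))"
  by (simp only: sum.lessThan_Suc_shift funpow_Suc_right o_def funpow_0)

lemma birkhoff_sum_le_max_sum: "(\<Sum>i<n. g ((U ^^ i) x)) \<le> max_sum U g n x"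
proof (induction n arbitrary: x)
  case (Suc n)
  show ?case unfolding birkhoff_sum_Suc using Suc[of "U x"] by simp
qed simp

locale mp_system = prob_space +
  fixes U :: "'a \<Rightarrow> 'a"
  assumes U: "U \<in> measure_preserving M M"
begin

lemma U_measurable[measurable]: "U \<in> measurable M M"
  using U by (rule measure_preserving_measurable)

lemma U_pow_measurable[measurable]: "U ^^ n \<in> measurable M M"
  using U by (intro measure_preserving_measurable measure_preserving_funpow)

lemma max_sum_integrable:
  assumes "integrable M g"
  shows "integrable M (max_sum U g n)"
proof (induction n)
  case 0 then show ?case by simp
next
  case (Suc n)
  have "integrable M (\<lambda>x. max_sum U g n (U x))"
    using measure_preserving_integrable[OF U Suc] .
  then show ?case using assms by simp
qed

text \<open>By invariance \<open>?G\<close> and its composition with \<open>U\<close> have the same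
  integral. Where \<open>?G\<close> is positive the recursion gives
  \<open>?G x - ?G (U x) \<le> g x\<close>; where it vanishes the difference is at most 0.\<close>

lemma max_sum_integral_nonneg:
  assumes g: "integrable M g"
  shows "0 \<le> (\<integral>x. indicator {x \<in> space M. 0 < max_sum U g n x} x * g x \<partial>M)"
proof -
  let ?G = "max_sum U g n"
  have G: "integrable M ?G" using max_sum_integrable[OF g] .
  have [measurable]: "?G \<in> borel_measurable M" using G by simp
  have GU: "integrable M (\<lambda>x. ?G (U x))"
    using measure_preserving_integrable[OF U G] .
  have [measurable]: "g \<in> borel_measurable M" using g by simp
  have "0 = (\<integral>x. ?G x \<partial>M) - (\<integral>x. ?G (U x) \<partial>M)"
    using measure_preserving_integral[OF U, of ?G] by simp
  also have "\<dots> = (\<integral>x. ?G x - ?G (U x) \<partial>M)"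
    using G GU by simp
  also have "\<dots> \<le> (\<integral>x. indicator {x \<in> space M. 0 < ?G x} x * g x \<partial>M)"
  proof (rule integral_mono)
    show "integrable M (\<lambda>x. ?G x - ?G (U x))" using G GU by simp
    show "integrable M (\<lambda>x. indicator {x \<in> space M. 0 < ?G x} x * g x)"
      using integrable_mult_indicator[OF _ g, of "{x \<in> space M. 0 < max_sum U g n x}"] by simp
  next
    fix x assume x: "x \<in> space M"
    show "?G x - ?G (U x) \<le> indicator {x \<in> space M. 0 < ?G x} x * g x"
    proof (cases "0 < ?G x")
      case True
      have "?G x \<le> max 0 (g x + ?G (U x))"
        using max_sum_mono_Suc[of U g n x] by simp
      then show ?thesis using True x by (auto simp: max_def split: if_splits)
    next
      case False
      then show ?thesis using max_sum_nonneg[of U g n x] max_sum_nonneg[of U g n "U x"] x by simp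
    qed
  qed
  finally show ?thesis .
qed

text \<open>The sets \<open>0 < max_sum U g n x\<close> increase with \<open>n\<close>, so their
  indicators are eventually constant at each point, and \<open>\<bar>g x\<bar>\<close>
  dominates.\<close>

lemma maximal_ergodic:
  assumes g: "integrable M g"
  shows "0 \<le> (\<integral>x. indicator {x \<in> space M. \<exists>n. 0 < max_sum U g n x} x * g x \<partial>M)"
proof -
  have [measurable]: "max_sum U g n \<in> borel_measurable M" for n using max_sum_integrable[OF g] by auto
  have [measurable]: "g \<in> borel_measurable M" using g by simp
  have "(\<lambda>n. \<integral>x. indicator {x \<in> space M. 0 < max_sum U g n x} x * g x \<partial>M) \<longlonglongrightarrow>
        (\<integral>x. indicator {x \<in> space M. \<exists>n. 0 < max_sum U g n x} x * g x \<partial>M)"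
  proof (rule integral_dominated_convergence)
    show "integrable M (\<lambda>x. \<bar>g x\<bar>)" using g by simp
    show "AE x in M. (\<lambda>n. indicator {x \<in> space M. 0 < max_sum U g n x} x * g x) \<longlonglongrightarrow>
        indicator {x \<in> space M. \<exists>n. 0 < max_sum U g n x} x * g x"
    proof (rule AE_I2)
      fix x assume x: "x \<in> space M"
      show "(\<lambda>n. indicator {x \<in> space M. 0 < max_sum U g n x} x * g x) \<longlonglongrightarrow>
        indicator {x \<in> space M. \<exists>n. 0 < max_sum U g n x} x * g x"
      proof (cases "\<exists>n. 0 < max_sum U g n x")
        case True
        then obtain m where m: "0 < max_sum U g m x" by auto
        have "eventually (\<lambda>n. indicator {x \<in> space M. 0 < max_sum U g n x} x * g x =
          indicator {x \<in> space M. \<exists>n. 0 < max_sum U g n x} x * g x) sequentially"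
          using eventually_ge_at_top[of m]
        proof eventually_elim
          case (elim n)
          then have "0 < max_sum U g n x" using max_sum_mono[OF elim, of U g x] m by linarith
          then show ?case using x by (auto simp: indicator_def)
        qed
        then show ?thesis by (rule tendsto_eventually)
      qed (simp add: x)
    qed
  qed (auto simp: indicator_def)
  then show ?thesis
    by (rule LIMSEQ_le_const) (auto intro: max_sum_integral_nonneg[OF g])
qed

text \<open>Weak-type bound: an average of \<open>indicator C\<close> exceeds \<open>c\<close>
  exactly when a Birkhoff sum of \<open>indicator C - c\<close> is positive. Its constant is the
  same for all \<open>C\<close>.\<close>

lemma maximal_inequality:
  assumes C[measurable]: "C \<in> sets M" and c: "0 < c"
  shows "c * measure M {x \<in> space M. \<exists>n. c * real n < (\<Sum>i<n. indicator C ((U ^^ i) x))} \<le> measure M C"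
proof -
  define g where "g x = indicator C x - c" for x
  have g: "integrable M g"
    unfolding g_def using c by (intro integrable_const_bound[of _ "1 + c"]) (auto simp: indicator_def)
  have [measurable]: "max_sum U g n \<in> borel_measurable M" for n using max_sum_integrable[OF g] by auto
  let ?E = "{x \<in> space M. \<exists>n. 0 < max_sum U g n x}"
  have "{x \<in> space M. \<exists>n. c * real n < (\<Sum>i<n. indicator C ((U ^^ i) x))} \<subseteq> ?E"
  proof safe
    fix x n assume "c * real n < (\<Sum>i<n. indicator C ((U ^^ i) x))"
    then have "0 < (\<Sum>i<n. g ((U ^^ i) x))" by (simp add: g_def sum_subtractf mult.commute)
    then show "\<exists>n. 0 < max_sum U g n x" using birkhoff_sum_le_max_sum[of g U x n] by (intro exI[of _ n]) linarith
  qed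
  then have 1: "c * measure M {x \<in> space M. \<exists>n. c * real n < (\<Sum>i<n. indicator C ((U ^^ i) x))} \<le> c * measure M ?E"
    using c by (intro mult_left_mono finite_measure_mono) auto
  have "0 \<le> (\<integral>x. indicator ?E x * g x \<partial>M)" using maximal_ergodic[OF g] .
  also have "\<dots> \<le> (\<integral>x. indicator C x - c * indicator ?E x \<partial>M)"
  proof (rule integral_mono)
    show "integrable M (\<lambda>x. indicator ?E x * g x)"
      using integrable_mult_indicator[OF _ g, of ?E] by simp
    show "integrable M (\<lambda>x. indicator C x - c * indicator ?E x)"
      using c by (intro integrable_const_bound[of _ "1 + c"]) (auto simp: indicator_def)
  qed (auto simp: g_def indicator_def)
  also have "\<dots> = measure M C - c * measure M ?E"
    by (subst Bochner_Integration.integral_diff)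
      (auto intro!: integrable_real_indicator simp: less_top[symmetric])
  finally show ?thesis using 1 by linarith
qed


section \<open>Pointwise convergence of Birkhoff averages\<close>

definition birkhoff_avg :: "('a \<Rightarrow> real) \<Rightarrow> nat \<Rightarrow> 'a \<Rightarrow> real" where
  "birkhoff_avg f n x = (\<Sum>i<n. f ((U ^^ i) x)) / real n"

lemma birkhoff_avg_measurable[measurable]:
  assumes [measurable]: "f \<in> borel_measurable M"
  shows "birkhoff_avg f n \<in> borel_measurable M"
  unfolding birkhoff_avg_def[abs_def] by measurable

lemma birkhoff_avg_bounds:
  assumes "\<And>x. 0 \<le> f x" "\<And>x. f x \<le> 1"
  shows "0 \<le> birkhoff_avg f n x" "birkhoff_avg f n x \<le> 1"
proof -
  show "0 \<le> birkhoff_avg f n x"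
    unfolding birkhoff_avg_def using assms by (intro divide_nonneg_nonneg sum_nonneg) auto
  have "(\<Sum>i<n. f ((U ^^ i) x)) \<le> (\<Sum>i<n. 1)" by (intro sum_mono assms)
  then show "birkhoff_avg f n x \<le> 1"
    unfolding birkhoff_avg_def by (cases "n = 0") (auto simp: field_simps)
qed

text \<open>The two sums share all terms but the first of one and the last of the other, and these
  lie in [0, 1].\<close>

lemma birkhoff_avg_U_diff:
  assumes "\<And>x. 0 \<le> f x" "\<And>x. f x \<le> 1"
  shows "\<bar>birkhoff_avg f n (U x) - birkhoff_avg f n x\<bar> \<le> 1 / real n"
proof -
  have "(\<Sum>i<n. f ((U ^^ i) x)) + f ((U ^^ n) x) = f x + (\<Sum>i<n. f ((U ^^ i) (U x)))"
    using birkhoff_sum_Suc[of f U x n] by simp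
  then have "\<bar>(\<Sum>i<n. f ((U ^^ i) (U x))) - (\<Sum>i<n. f ((U ^^ i) x))\<bar> \<le> 1"
    using assms(1)[of x] assms(2)[of x] assms(1)[of "(U ^^ n) x"] assms(2)[of "(U ^^ n) x"] by linarith
  then show ?thesis
    unfolding birkhoff_avg_def diff_divide_distrib[symmetric] abs_divide
    by (simp add: divide_right_mono)
qed

text \<open>Invariance holds at every point, so sets defined by these limits are forward invariant
  without null-set corrections.\<close>

lemma birkhoff_lim_U:
  assumes "\<And>x. 0 \<le> f x" "\<And>x. f x \<le> 1"
  shows "limsup (\<lambda>n. ereal (birkhoff_avg f n (U x))) = limsup (\<lambda>n. ereal (birkhoff_avg f n x))"
    and "liminf (\<lambda>n. ereal (birkhoff_avg f n (U x))) = liminf (\<lambda>n. ereal (birkhoff_avg f n x))"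
proof -
  define e where "e n = birkhoff_avg f n (U x) - birkhoff_avg f n x" for n
  have "e \<longlonglongrightarrow> 0"
  proof (rule tendsto_rabs_zero_cancel, rule tendsto_sandwich[OF _ _ tendsto_const])
    show "\<forall>\<^sub>F n in sequentially. \<bar>e n\<bar> \<le> 1 / real n"
      unfolding e_def using birkhoff_avg_U_diff[OF assms] by auto
    show "(\<lambda>n. 1 / real n) \<longlonglongrightarrow> 0" by (rule lim_1_over_n)
  qed auto
  then have e: "(\<lambda>n. ereal (e n)) \<longlonglongrightarrow> 0" by (simp add: zero_ereal_def)
  have eq: "(\<lambda>n. ereal (birkhoff_avg f n (U x))) = (\<lambda>n. ereal (e n) + ereal (birkhoff_avg f n x))"
    by (auto simp: e_def)
  show "limsup (\<lambda>n. ereal (birkhoff_avg f n (U x))) = limsup (\<lambda>n. ereal (birkhoff_avg f n x))"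
    unfolding eq by (subst ereal_limsup_lim_add[OF e]) auto
  show "liminf (\<lambda>n. ereal (birkhoff_avg f n (U x))) = liminf (\<lambda>n. ereal (birkhoff_avg f n x))"
    unfolding eq by (subst ereal_liminf_lim_add[OF e]) auto
qed

text \<open>Orbits that start in \<open>E\<close> stay there, so along them the truncation
  \<open>indicator E x * h x\<close> has the same Birkhoff sums as \<open>h\<close>. Hence its
  maximal set contains \<open>E\<close>, and outside \<open>E\<close> the truncation is 0.\<close>

lemma maximal_ergodic_invariant:
  fixes h :: "'a \<Rightarrow> real"
  assumes h: "integrable M h" and E[measurable]: "E \<in> sets M"
    and inv: "\<And>x. x \<in> E \<Longrightarrow> U x \<in> E"
    and pos: "\<And>x. x \<in> E \<Longrightarrow> \<exists>n. 0 < (\<Sum>i<n. h ((U ^^ i) x))"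
  shows "0 \<le> (\<integral>x. indicator E x * h x \<partial>M)"
proof -
  define g where "g x = indicator E x * h x" for x
  have g: "integrable M g"
    using integrable_mult_indicator[OF E h] by (simp add: g_def[abs_def])
  have UE: "x \<in> E \<Longrightarrow> (U ^^ i) x \<in> E" for x i by (induction i) (auto intro: inv)
  have "(\<integral>x. indicator {x \<in> space M. \<exists>n. 0 < max_sum U g n x} x * g x \<partial>M) = (\<integral>x. g x \<partial>M)"
  proof (rule Bochner_Integration.integral_cong[OF refl])
    fix x assume x: "x \<in> space M"
    show "indicator {x \<in> space M. \<exists>n. 0 < max_sum U g n x} x * g x = g x"
    proof (cases "x \<in> E")
      case True
      from pos[OF this] obtain n where "0 < (\<Sum>i<n. h ((U ^^ i) x))" ..
      also have "\<dots> = (\<Sum>i<n. g ((U ^^ i) x))" using UE[OF True] by (simp add: g_def)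
      also have "\<dots> \<le> max_sum U g n x" by (rule birkhoff_sum_le_max_sum)
      finally show ?thesis using x by (auto simp: indicator_def)
    qed (simp add: g_def)
  qed
  then show ?thesis using maximal_ergodic[OF g] by (simp add: g_def)
qed

text \<open>On the invariant set where the lower limit is below \<open>a\<close> and the upper limit
  above \<open>b\<close>, both \<open>f - b\<close> and \<open>a - f\<close> have nonnegative
  integral. The sum is \<open>(a - b) * measure M E\<close> with \<open>a < b\<close>, which forces
  the set to be null; rational pairs \<open>a < b\<close> suffice.\<close>

theorem birkhoff_Cauchy:
  assumes [measurable]: "f \<in> borel_measurable M" and f: "\<And>x. 0 \<le> f x" "\<And>x. f x \<le> 1"
  shows "AE x in M. Cauchy (\<lambda>n. birkhoff_avg f n x)"
proof -
  define l where "l x = liminf (\<lambda>n. ereal (birkhoff_avg f n x))" for x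
  define L where "L x = limsup (\<lambda>n. ereal (birkhoff_avg f n x))" for x
  have [measurable]: "l \<in> borel_measurable M" "L \<in> borel_measurable M"
    unfolding l_def[abs_def] L_def[abs_def] by measurable
  have f_int: "integrable M f"
    by (rule integrable_const_bound[of _ 1]) (auto simp: f abs_of_nonneg)
  have null: "AE x in M. \<not> (l x < ereal a \<and> ereal b < L x)" if "a < b" for a b
  proof -
    define E where "E = {x \<in> space M. l x < ereal a \<and> ereal b < L x}"
    have E[measurable]: "E \<in> sets M" unfolding E_def by measurable
    have inv: "U x \<in> E" if "x \<in> E" for x
      using that measurable_space[OF U_measurable, of x] birkhoff_lim_U[of f x, OF f]
      by (simp add: E_def l_def L_def)
    have nonpos: "0 \<le> (\<integral>x. indicator E x * (f x - b) \<partial>M)"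
    proof (rule maximal_ergodic_invariant[OF _ E inv])
      fix x assume x: "x \<in> E"
      have "\<exists>n>0. b < birkhoff_avg f n x"
      proof (rule ccontr)
        assume no: "\<not> ?thesis"
        have "ereal (birkhoff_avg f n x) \<le> ereal b" if "1 \<le> n" for n
          using no that by (metis One_nat_def Suc_le_eq ereal_less_eq(3) not_less)
        then have "eventually (\<lambda>n. ereal (birkhoff_avg f n x) \<le> ereal b) sequentially"
          by (rule eventually_sequentiallyI)
        from Limsup_bounded[OF this] show False using x by (auto simp: E_def L_def)
      qed
      then obtain n where "n > 0" "b < birkhoff_avg f n x" by auto
      then have "0 < (\<Sum>i<n. f ((U ^^ i) x) - b)"
        by (simp add: birkhoff_avg_def sum_subtractf field_simps)
      then show "\<exists>n. 0 < (\<Sum>i<n. f ((U ^^ i) x) - b)" ..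
    qed (use f_int in auto)
    have nonneg: "0 \<le> (\<integral>x. indicator E x * (a - f x) \<partial>M)"
    proof (rule maximal_ergodic_invariant[OF _ E inv])
      fix x assume x: "x \<in> E"
      have "\<exists>n>0. birkhoff_avg f n x < a"
      proof (rule ccontr)
        assume no: "\<not> ?thesis"
        have "ereal a \<le> ereal (birkhoff_avg f n x)" if "1 \<le> n" for n
          using no that by (metis One_nat_def Suc_le_eq ereal_less_eq(3) not_less)
        then have "eventually (\<lambda>n. ereal a \<le> ereal (birkhoff_avg f n x)) sequentially"
          by (rule eventually_sequentiallyI)
        from Liminf_bounded[OF this] show False using x by (auto simp: E_def l_def)
      qed
      then obtain n where "n > 0" "birkhoff_avg f n x < a" by auto
      then have "0 < (\<Sum>i<n. a - f ((U ^^ i) x))"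
        by (simp add: birkhoff_avg_def sum_subtractf field_simps)
      then show "\<exists>n. 0 < (\<Sum>i<n. a - f ((U ^^ i) x))" ..
    qed (use f_int in auto)
    have i1: "integrable M (\<lambda>x. indicator E x * (f x - b))"
      using integrable_mult_indicator[OF E, of "\<lambda>x. f x - b"] f_int by simp
    have i2: "integrable M (\<lambda>x. indicator E x * (a - f x))"
      using integrable_mult_indicator[OF E, of "\<lambda>x. a - f x"] f_int by simp
    have "0 \<le> (\<integral>x. indicator E x * (f x - b) + indicator E x * (a - f x) \<partial>M)"
      using nonpos nonneg i1 i2 by simp
    also have "\<dots> = (\<integral>x. (a - b) * indicator E x \<partial>M)"
      by (rule Bochner_Integration.integral_cong) (auto simp: algebra_simps)
    also have "\<dots> = (a - b) * measure M E" by simp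
    finally have "measure M E = 0"
      using \<open>a < b\<close> measure_nonneg[of M E] by (simp add: zero_le_mult_iff)
    then have "emeasure M E = 0" by (simp add: emeasure_eq_measure)
    then show ?thesis by (intro AE_I[of _ _ E]) (auto simp: E_def)
  qed
  have "AE x in M. \<forall>a\<in>\<rat>. \<forall>b\<in>\<rat>. a < b \<longrightarrow> \<not> (l x < ereal a \<and> ereal b < L x)"
    unfolding AE_ball_countable[OF countable_rat] using null by auto
  then show ?thesis
  proof (rule AE_mp, intro AE_I2 impI)
    fix x assume rat: "\<forall>a\<in>\<rat>. \<forall>b\<in>\<rat>. a < b \<longrightarrow> \<not> (l x < ereal a \<and> ereal b < L x)"
    have lb: "0 \<le> l x" "L x \<le> 1"
      unfolding l_def L_def
      by (auto intro!: Liminf_bounded Limsup_bounded simp: birkhoff_avg_bounds[of f, OF f])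
    have lL: "l x \<le> L x" unfolding l_def L_def by (rule Liminf_le_Limsup) simp
    have "l x = L x"
    proof (rule ccontr)
      assume "l x \<noteq> L x"
      then have lt: "real_of_ereal (l x) < real_of_ereal (L x)" and fin: "\<bar>l x\<bar> \<noteq> \<infinity>" "\<bar>L x\<bar> \<noteq> \<infinity>"
        using lb lL by (cases "l x"; cases "L x"; auto)+
      from Rats_dense_in_real[OF lt] obtain a where a: "a \<in> \<rat>" "real_of_ereal (l x) < a" "a < real_of_ereal (L x)" by auto
      from Rats_dense_in_real[OF a(3)] obtain b where b: "b \<in> \<rat>" "a < b" "b < real_of_ereal (L x)" by auto
      have "l x < ereal a" "ereal b < L x"
        using fin a b by (cases "l x"; cases "L x"; auto)+
      with rat a b show False by auto
    qed
    moreover obtain r where "L x = ereal r"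
      using lb lL by (cases "L x") auto
    ultimately have "(\<lambda>n. ereal (birkhoff_avg f n x)) \<longlonglongrightarrow> ereal r"
      by (subst tendsto_iff_Liminf_eq_Limsup) (simp_all add: l_def L_def)
    then show "Cauchy (\<lambda>n. birkhoff_avg f n x)"
      by (intro LIMSEQ_imp_Cauchy) simp
  qed
qed

text \<open>Comparing with the average at time \<open>N\<close>, which has the same integral as \<open>f\<close>, makes the limit
  function unnecessary.\<close>
lemma birkhoff_uniform_Cauchy:
  assumes f[measurable]: "f \<in> borel_measurable M" "\<And>x. 0 \<le> f x" "\<And>x. f x \<le> 1" and "0 < \<tau>" "0 < \<beta>"
  obtains N where "0 < N"
    "measure M {x \<in> space M. \<exists>n\<ge>N. \<exists>m\<ge>N. \<tau> < \<bar>birkhoff_avg f n x - birkhoff_avg f m x\<bar>} < \<beta>"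
proof -
  \<comment> \<open>The shift to \<open>Suc k\<close> makes the resulting threshold positive, so
    that \<open>birkhoff_avg_integral\<close> applies at that time.\<close>
  define A where "A k = {x \<in> space M. \<exists>n\<ge>Suc k. \<exists>m\<ge>Suc k. \<tau> < \<bar>birkhoff_avg f n x - birkhoff_avg f m x\<bar>}" for k
  have A[measurable]: "A k \<in> sets M" for k unfolding A_def by measurable
  have "(\<lambda>k. measure M (A k)) \<longlonglongrightarrow> measure M (\<Inter>k. A k)"
  proof (rule finite_Lim_measure_decseq)
    show "decseq A" unfolding decseq_def A_def by (blast intro: order_trans Suc_le_mono[THEN iffD2])
  qed auto
  also have "measure M (\<Inter>k. A k) = 0"
  proof -
    have "AE x in M. x \<notin> (\<Inter>k. A k)"
    proof (rule AE_mp[OF birkhoff_Cauchy[OF f]], intro AE_I2 impI notI)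
      fix x assume c: "Cauchy (\<lambda>n. birkhoff_avg f n x)" and x: "x \<in> (\<Inter>k. A k)"
      from c \<open>0 < \<tau>\<close> obtain N where N: "\<And>m n. m \<ge> N \<Longrightarrow> n \<ge> N \<Longrightarrow> \<bar>birkhoff_avg f m x - birkhoff_avg f n x\<bar> < \<tau>"
        unfolding Cauchy_def dist_real_def by blast
      have "x \<in> A N" using x by blast
      then obtain n m where "n \<ge> Suc N" "m \<ge> Suc N" "\<tau> < \<bar>birkhoff_avg f n x - birkhoff_avg f m x\<bar>"
        unfolding A_def by blast
      with N[of n m] show False by simp
    qed
    then show ?thesis by (intro measure_eq_0_null_sets) (auto simp: AE_iff_null_sets)
  qed
  finally have "eventually (\<lambda>k. measure M (A k) < \<beta>) sequentially"
    using \<open>0 < \<beta>\<close> by (simp add: order_tendsto_iff)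
  then obtain k where "measure M (A k) < \<beta>" by (auto simp: eventually_sequentially)
  then show ?thesis using that[of "Suc k"] by (simp add: A_def)
qed

lemma birkhoff_avg_integral:
  assumes f[measurable]: "f \<in> borel_measurable M" "\<And>x. 0 \<le> f x" "\<And>x. f x \<le> 1" and "0 < n"
  shows "(\<integral>x. birkhoff_avg f n x \<partial>M) = (\<integral>x. f x \<partial>M)"
proof -
  have mp: "U ^^ i \<in> measure_preserving M M" for i by (rule measure_preserving_funpow[OF U])
  have "integrable M f"
    by (rule integrable_const_bound[of _ 1]) (auto simp: f abs_of_nonneg)
  then have i: "integrable M (\<lambda>x. f ((U ^^ i) x))" for i
    by (rule measure_preserving_integrable[OF mp])
  have "(\<integral>x. birkhoff_avg f n x \<partial>M) = (\<Sum>i<n. \<integral>x. f ((U ^^ i) x) \<partial>M) / n"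
    unfolding birkhoff_avg_def using i by simp
  also have "\<dots> = (\<integral>x. f x \<partial>M)"
    using \<open>0 < n\<close> by (simp add: measure_preserving_integral[OF mp f(1)])
  finally show ?thesis .
qed

end

section \<open>Maps that move points along their orbits\<close>

lemma AE_lborel_shift:
  fixes P :: "real \<Rightarrow> bool"
  assumes [measurable]: "Measurable.pred borel P"
  shows "(AE s in lborel. P (s + t)) \<longleftrightarrow> (AE s in lborel. P s)"
proof -
  have "(AE s in lborel. P s) \<longleftrightarrow> (AE s in distr lborel borel ((+) t). P s)"
    by (simp only: lborel_distr_plus)
  also have "\<dots> \<longleftrightarrow> (AE s in lborel. P (t + s))"
    by (subst AE_distr_iff) auto
  finally show ?thesis by (simp add: add.commute)
qed

lemma AE_lborel_const: "(AE s::real in lborel. P) \<Longrightarrow> P"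
proof (rule ccontr)
  assume "AE s::real in lborel. P" "\<not> P"
  then have "AE s::real in lborel. s \<notin> UNIV" by simp
  then have "emeasure lborel (UNIV :: real set) = 0"
    by (subst (asm) AE_iff_measurable[OF _ refl]) auto
  then show False by simp
qed

locale ergodic_mp_flow = prob_space +
  fixes T :: "real \<Rightarrow> 'a \<Rightarrow> 'a"
  assumes flow: "measurable_flow M T" and ergodic: "ergodic_flow M T"
begin

lemma T_0 [simp]: "T 0 x = x"
  and T_add: "T (s + t) x = T s (T t x)"
  and T_mp: "T t \<in> measure_preserving M M"
  using flow by (auto simp: measurable_flow_def)

lemma T_joint: "(\<lambda>(x, t). T t x) \<in> M \<Otimes>\<^sub>M lborel \<rightarrow>\<^sub>M M"
  using flow by (auto simp: measurable_flow_def)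

lemma T_joint' [measurable (raw)]:
  assumes [measurable]: "f \<in> K \<rightarrow>\<^sub>M M" "g \<in> K \<rightarrow>\<^sub>M borel"
  shows "(\<lambda>x. T (g x) (f x)) \<in> K \<rightarrow>\<^sub>M M"
proof -
  have "(\<lambda>x. (f x, g x)) \<in> K \<rightarrow>\<^sub>M M \<Otimes>\<^sub>M lborel"
    by (intro measurable_Pair) auto
  from measurable_compose[OF this T_joint] show ?thesis by simp
qed

lemma T_space [simp]: "x \<in> space M \<Longrightarrow> T t x \<in> space M"
  using measurable_space[OF measure_preserving_measurable[OF T_mp]] by blast

lemma T_commute: "T s (T t x) = T t (T s x)"
  by (metis T_add add.commute)

lemma T_minus [simp]: "T (- t) (T t x) = x" "T t (T (- t) x) = x"
  by (simp_all flip: T_add)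

lemma T_inject: "T t x = T t y \<longleftrightarrow> x = y"
  by (metis T_minus(1))

text \<open>A set that is invariant only up to null sets (depending on \<open>t\<close>) is replaced by the
  strictly invariant set of points whose orbit lies in it for almost all times.\<close>
lemma AE_invariant_measure_0_1:
  assumes A[measurable]: "A \<in> sets M" and inv: "\<And>t. AE x in M. T t x \<in> A \<longleftrightarrow> x \<in> A"
  shows "measure M A = 0 \<or> measure M A = 1"
proof -
  interpret pair_sigma_finite M lborel ..
  define B where "B = {x \<in> space M. AE s in lborel. T s x \<in> A}"
  \<comment> \<open>A condition for almost all times becomes the vanishing of an integral over time,
    which depends measurably on \<open>x\<close> by Tonelli.\<close>
  have "B = {x \<in> space M. (\<integral>\<^sup>+s. indicator (space M - A) (T s x) \<partial>lborel) = 0}"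
    unfolding B_def
    by (intro Collect_cong conj_cong refl, subst nn_integral_0_iff_AE) (auto simp: indicator_def)
  also have "\<dots> \<in> sets M" by measurable
  finally have B[measurable]: "B \<in> sets M" .
  have "T t -` B \<inter> space M = B" for t
  proof -
    have "(AE s in lborel. T s (T t x) \<in> A) \<longleftrightarrow> (AE s in lborel. T s x \<in> A)" if x: "x \<in> space M" for x
    proof -
      have [measurable]: "(\<lambda>s. T s x) \<in> borel \<rightarrow>\<^sub>M M" using x by measurable
      show ?thesis by (simp flip: T_add, subst AE_lborel_shift) auto
    qed
    then show ?thesis
      by (intro set_eqI) (simp only: B_def vimage_def Int_iff mem_Collect_eq, metis T_space)
  qed
  then have B01: "measure M B = 0 \<or> measure M B = 1"
    using ergodic B unfolding ergodic_flow_def by blast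
  have *: "{x \<in> space (M \<Otimes>\<^sub>M lborel). T (snd x) (fst x) \<in> A \<longleftrightarrow> fst x \<in> A} \<in> sets (M \<Otimes>\<^sub>M lborel)"
    by measurable
  \<comment> \<open>Fubini trades the null sets depending on time for a single null set of
    points.\<close>
  have "AE s in lborel. AE x in M. T s x \<in> A \<longleftrightarrow> x \<in> A" using inv by simp
  then have "AE x in M. AE s in lborel. T s x \<in> A \<longleftrightarrow> x \<in> A"
    using AE_commute[OF *] by simp
  then have "AE x in M. x \<in> A \<longleftrightarrow> x \<in> B"
  proof (rule AE_mp, intro AE_I2 impI)
    fix x assume x: "x \<in> space M" and ae: "AE s in lborel. T s x \<in> A \<longleftrightarrow> x \<in> A"
    show "x \<in> A \<longleftrightarrow> x \<in> B"
    proof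
      assume "x \<in> A" with ae x show "x \<in> B" by (simp add: B_def)
    next
      assume "x \<in> B"
      then have "AE s in lborel. T s x \<in> A" by (simp add: B_def)
      with ae have "AE s::real in lborel. x \<in> A" by eventually_elim simp
      then show "x \<in> A" by (rule AE_lborel_const)
    qed
  qed
  then have "measure M A = measure M B" by (intro finite_measure_eq_AE) auto
  with B01 show ?thesis by simp
qed

section \<open>Averages along orbits and the coordinates they yield\<close>

definition orbit_int :: "('a \<Rightarrow> real) \<Rightarrow> real \<Rightarrow> real \<Rightarrow> 'a \<Rightarrow> real" where
  "orbit_int f a b x = (\<integral>s. indicator {a<..b} s * f (T s x) \<partial>lborel)"

lemma orbit_int_measurable[measurable]:
  assumes [measurable]: "f \<in> borel_measurable M"
  shows "orbit_int f a b \<in> borel_measurable M"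
  unfolding orbit_int_def[abs_def] by measurable

lemma orbit_measurable:
  assumes "x \<in> space M"
  shows "(\<lambda>s. T s x) \<in> borel \<rightarrow>\<^sub>M M"
  using assms by measurable

text \<open>Flowing merely translates the interval of integration. This is the source of continuity
  along orbits for an \<open>f\<close> that is only measurable.\<close>

lemma orbit_int_T:
  shows "orbit_int f a b (T t x) = orbit_int f (a + t) (b + t) x"
proof -
  have "orbit_int f (a + t) (b + t) x = (\<integral>s. indicator {a + t<..b + t} (t + 1 * s) * f (T (t + 1 * s) x) \<partial>lborel)"
    unfolding orbit_int_def by (subst lborel_integral_real_affine[of 1 _ t]) auto
  also have "\<dots> = orbit_int f a b (T t x)"
    unfolding orbit_int_def
    by (rule Bochner_Integration.integral_cong) (auto simp: indicator_def T_add T_commute add.commute)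
  finally show ?thesis by simp
qed

text \<open>The integrands converge at every time except possibly the two endpoints \<open>a\<close>
  and \<open>b\<close>, and a fixed bounded interval dominates them.\<close>

lemma orbit_int_tendsto:
  assumes [measurable]: "f \<in> borel_measurable M" and f: "\<And>x. 0 \<le> f x" "\<And>x. f x \<le> 1"
    and x: "x \<in> space M" and a: "(an \<longlongrightarrow> a) sequentially" and b: "(bn \<longlongrightarrow> b) sequentially"
  shows "(\<lambda>n. orbit_int f (an n) (bn n) x) \<longlonglongrightarrow> orbit_int f a b x"
proof -
  have [measurable]: "(\<lambda>s. T s x) \<in> borel \<rightarrow>\<^sub>M M" using x by (rule orbit_measurable)
  obtain K1 K2 where K: "\<And>n. \<bar>an n\<bar> \<le> K1" "\<And>n. \<bar>bn n\<bar> \<le> K2"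
    using convergent_imp_Bseq[OF convergentI[OF a]] convergent_imp_Bseq[OF convergentI[OF b]]
    unfolding Bseq_def by (auto simp: real_norm_def)
  show ?thesis unfolding orbit_int_def
  proof (rule integral_dominated_convergence)
    show "integrable lborel (indicator {- K1..K2} :: real \<Rightarrow> real)"
      by (intro integrable_real_indicator) (auto simp: emeasure_lborel_Icc_eq)
    have "AE s in lborel. s \<noteq> a" "AE s in lborel. s \<noteq> b"
      using AE_lborel_singleton by auto
    then show "AE s in lborel. (\<lambda>n. indicator {an n<..bn n} s * f (T s x)) \<longlonglongrightarrow> indicator {a<..b} s * f (T s x)"
    proof eventually_elim
      case (elim s)
      have A: "eventually (\<lambda>n. (an n < s) = (a < s)) sequentially"
      proof (cases "a < s")
        case True
        from order_tendstoD(2)[OF a this] show ?thesis by eventually_elim (simp add: True)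
      next
        case False
        then have "s < a" using elim by simp
        from order_tendstoD(1)[OF a this] show ?thesis by eventually_elim (use False in simp)
      qed
      have B: "eventually (\<lambda>n. (s \<le> bn n) = (s \<le> b)) sequentially"
      proof (cases "s < b")
        case True
        from order_tendstoD(1)[OF b this] show ?thesis by eventually_elim (use True in simp)
      next
        case False
        then have "b < s" using elim by simp
        from order_tendstoD(2)[OF b this] show ?thesis by eventually_elim (use False elim in simp)
      qed
      from A B have "eventually (\<lambda>n. indicator {an n<..bn n} s * f (T s x) = indicator {a<..b} s * f (T s x)) sequentially"
        by eventually_elim (simp add: indicator_def)
      then show ?case by (rule tendsto_eventually)
    qed
    show "AE s in lborel. norm (indicator {an n<..bn n} s * f (T s x)) \<le> indicator {- K1..K2} s" for n
      using K(1)[of n] K(2)[of n] by (intro AE_I2) (auto simp: indicator_def f)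
  qed measurable
qed

text \<open>The integrals over all intervals from \<open>u\<close> to 1 are the tails of a finite
  measure on the line, hence determine that measure and its density up to null sets. Rational
  \<open>u\<close> suffice by continuity in the endpoint.\<close>

lemma orbit_int_eq_imp:
  assumes [measurable]: "f \<in> borel_measurable M" and f: "\<And>x. 0 \<le> f x" "\<And>x. f x \<le> 1"
    and x: "x \<in> space M" and y: "y \<in> space M"
    and eq: "\<And>q. q \<in> \<rat> \<Longrightarrow> orbit_int f q 1 x = orbit_int f q 1 y"
  shows "AE s in lborel. s \<in> {0<..1} \<longrightarrow> f (T s x) = f (T s y)"
proof -
  have eq': "orbit_int f u 1 x = orbit_int f u 1 y" for u
  proof -
    have "\<exists>q\<in>\<rat>. u < q \<and> q < u + 1 / real (Suc n)" for n
      using Rats_dense_in_real[of u "u + 1 / real (Suc n)"] by auto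
    then obtain q where q: "\<And>n. q n \<in> \<rat>" "\<And>n. u < q n" "\<And>n. q n < u + 1 / real (Suc n)"
      by metis
    have "q \<longlonglongrightarrow> u"
    proof (rule tendsto_sandwich[OF _ _ tendsto_const])
      show "(\<lambda>n. u + 1 / real (Suc n)) \<longlonglongrightarrow> u"
        using tendsto_add[OF tendsto_const LIMSEQ_inverse_real_of_nat, of u] by (simp add: inverse_eq_divide)
    qed (use q in \<open>auto intro!: always_eventually less_imp_le simp del: of_nat_Suc\<close>)
    then have "(\<lambda>n. orbit_int f (q n) 1 x) \<longlonglongrightarrow> orbit_int f u 1 x"
      "(\<lambda>n. orbit_int f (q n) 1 y) \<longlonglongrightarrow> orbit_int f u 1 y"
      using orbit_int_tendsto[OF assms(1) f] x y by auto
    then show ?thesis using eq q(1) LIMSEQ_unique by force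
  qed
  define D where "D z = density lborel (\<lambda>s. ennreal (indicator {0<..1} s * f (T s z)))" for z
  \<comment> \<open>The density lives on \<open>{0<..1}\<close>, so a tail from a negative
    \<open>u\<close> is the tail from 0.\<close>
  have em: "emeasure (D z) {u<..} = ennreal (orbit_int f (max 0 u) 1 z)" if z: "z \<in> space M" for z u
  proof -
    have [measurable]: "(\<lambda>s. T s z) \<in> borel \<rightarrow>\<^sub>M M" using z by (rule orbit_measurable)
    have "emeasure (D z) {u<..} = (\<integral>\<^sup>+s. ennreal (indicator {max 0 u<..1} s * f (T s z)) \<partial>lborel)"
      unfolding D_def by (subst emeasure_density) (auto intro!: nn_integral_cong simp: indicator_def)
    also have "\<dots> = ennreal (orbit_int f (max 0 u) 1 z)"
      unfolding orbit_int_def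
    proof (rule nn_integral_eq_integral)
      show "integrable lborel (\<lambda>s. indicator {max 0 u<..1} s * f (T s z))"
      proof (rule Bochner_Integration.integrable_bound[of _ "indicator {0..1} :: real \<Rightarrow> real"])
        show "integrable lborel (indicator {0..1} :: real \<Rightarrow> real)"
          by (intro integrable_real_indicator) (auto simp: emeasure_lborel_Icc_eq)
      qed (auto intro!: AE_I2 simp: indicator_def f)
    qed (auto simp: f)
    finally show ?thesis .
  qed
  have "D x = D y"
  proof (rule measure_eqI_lessThan)
    show "emeasure (D x) {u<..} < \<infinity>" for u by (simp add: em[OF x])
    show "emeasure (D x) {u<..} = emeasure (D y) {u<..}" for u
      by (simp add: em[OF x] em[OF y] eq')
  qed (simp_all add: D_def)
  have [measurable]: "(\<lambda>s. T s x) \<in> borel \<rightarrow>\<^sub>M M" "(\<lambda>s. T s y) \<in> borel \<rightarrow>\<^sub>M M"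
    using x y by (auto intro: orbit_measurable)
  have "AE s in lborel. ennreal (indicator {0<..1} s * f (T s x)) = ennreal (indicator {0<..1} s * f (T s y))"
    using \<open>D x = D y\<close> unfolding D_def
    by (subst (asm) sigma_finite_measure.density_unique_iff[OF sigma_finite_lborel]) auto
  then show ?thesis by eventually_elim (auto simp: f)
qed


text \<open>Functions that separate points and are continuous along orbits: they make
  \<open>\<exists>t\<in>{a..b}. R x = T t x\<close> equivalent to a condition over rational \<open>t\<close>.\<close>
definition orbit_coords :: "(nat \<Rightarrow> 'a \<Rightarrow> real) \<Rightarrow> bool" where
  "orbit_coords c \<longleftrightarrow> (\<forall>i. c i \<in> borel_measurable M) \<and>
     (\<forall>i. \<forall>x\<in>space M. continuous_on UNIV (\<lambda>t. c i (T t x))) \<and>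
     (\<forall>x\<in>space M. \<forall>y\<in>space M. (\<forall>i. c i x = c i y) \<longrightarrow> x = y)"

text \<open>Equal coordinates force, for almost all \<open>s\<close> in \<open>{0<..1}\<close>, that
  every \<open>F j\<close> agrees at \<open>T s x\<close> and \<open>T s y\<close>. One such
  \<open>s\<close> gives \<open>T s x = T s y\<close>, and \<open>T s\<close> is injective.\<close>

lemma orbit_coords_exist:
  fixes F :: "nat \<Rightarrow> 'a \<Rightarrow> real"
  assumes [measurable]: "\<And>j. F j \<in> borel_measurable M"
    and F: "\<And>j x. 0 \<le> F j x" "\<And>j x. F j x \<le> 1"
    and sep: "\<And>x y. x \<in> space M \<Longrightarrow> y \<in> space M \<Longrightarrow> (\<And>j. F j x = F j y) \<Longrightarrow> x = y"
  obtains c where "orbit_coords c"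
proof
  \<comment> \<open>The index codes a pair: a function \<open>F j\<close> and a rational left
    endpoint.\<close>
  define c where "c i = orbit_int (F (fst (prod_decode i))) (from_nat_into \<rat> (snd (prod_decode i))) 1" for i
  have c_eq: "orbit_int (F j) q 1 = c (prod_encode (j, to_nat_on \<rat> q))" if "q \<in> \<rat>" for j q
    using that by (simp add: c_def countable_rat)
  show "orbit_coords c"
    unfolding orbit_coords_def
  proof (intro conjI allI ballI impI)
    show "c i \<in> borel_measurable M" for i unfolding c_def by measurable
    show "continuous_on UNIV (\<lambda>t. c i (T t x))" if x: "x \<in> space M" for i x
      unfolding continuous_on_sequentially o_def c_def orbit_int_T
      using x F by (auto intro!: orbit_int_tendsto tendsto_intros)
    fix x y assume x: "x \<in> space M" and y: "y \<in> space M" and eq: "\<forall>i. c i x = c i y"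
    have "AE s in lborel. s \<in> {0<..1} \<longrightarrow> F j (T s x) = F j (T s y)" for j
      using eq by (intro orbit_int_eq_imp F x y) (auto simp: c_eq)
    then have "AE s in lborel. \<forall>j. s \<in> {0<..1} \<longrightarrow> F j (T s x) = F j (T s y)"
      unfolding AE_all_countable by (rule allI)
    then have "AE s in lborel. s \<in> {0<..1::real} \<longrightarrow> x = y"
    proof eventually_elim
      case (elim s)
      then show ?case using sep[of "T s x" "T s y"] x y by (auto simp: T_inject)
    qed
    moreover have "\<not> (AE s in lborel. s \<notin> {0<..1::real})"
      by (subst AE_iff_measurable[of "{0<..1}"]) auto
    ultimately show "x = y" by (cases "x = y") auto
  qed
qed

section \<open>Measurability and invariance of the set of points moved along their orbit\<close>

definition orbit_set :: "('a \<Rightarrow> 'a) \<Rightarrow> real \<Rightarrow> real \<Rightarrow> 'a set" where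
  "orbit_set R a b = {x \<in> space M. \<exists>t\<in>{a..b}. R x = T t x}"

text \<open>An exact time is approximated by rational times; the margin \<open>1 / Suc m\<close>
  leaves room for them at an endpoint and when \<open>a = b\<close>. Conversely, approximate times
  accumulate at some \<open>t0\<close> in \<open>{a..b}\<close> by compactness, and continuity makes
  all coordinates of \<open>T t0 x\<close> and \<open>R x\<close> equal.\<close>

lemma orbit_set_iff:
  assumes c: "orbit_coords c" and R: "R \<in> M \<rightarrow>\<^sub>M M" and x: "x \<in> space M"
  shows "x \<in> orbit_set R a b \<longleftrightarrow>
    (\<forall>m. \<exists>t\<in>\<rat>. a - 1 / Suc m < t \<and> t < b + 1 / Suc m \<and> (\<forall>i<m. \<bar>c i (T t x) - c i (R x)\<bar> < 1 / Suc m))"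
    (is "_ \<longleftrightarrow> (\<forall>m. \<exists>t\<in>\<rat>. ?P m t)")
proof
  have Rx: "R x \<in> space M" using measurable_space[OF R x] .
  have cont: "continuous_on UNIV (\<lambda>t. c i (T t x))" for i
    using c x by (simp add: orbit_coords_def)
  {
    assume "x \<in> orbit_set R a b"
    then obtain t where t: "a \<le> t" "t \<le> b" "R x = T t x" by (auto simp: orbit_set_def)
    show "\<forall>m. \<exists>t\<in>\<rat>. ?P m t"
    proof
      fix m
      define V where "V = {a - 1 / Suc m<..<b + 1 / Suc m} \<inter>
        (\<Inter>i\<in>{..<m}. {s. \<bar>c i (T s x) - c i (R x)\<bar> < 1 / Suc m})"
      have "open V"
        unfolding V_def
        by (intro open_Int open_INT finite_lessThan ballI open_Collect_less continuous_intros cont) auto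
      moreover have "t \<in> V"
      proof -
        have "0 < 1 / real (Suc m)" by simp
        then have "a - 1 / Suc m < t" "t < b + 1 / Suc m" using t by linarith+
        then show ?thesis using t by (simp add: V_def)
      qed
      ultimately obtain e where e: "e > 0" "\<And>s. dist s t < e \<Longrightarrow> s \<in> V"
        unfolding open_dist by blast
      obtain q where "q \<in> \<rat>" "t < q" "q < t + e"
        using Rats_dense_in_real[of t "t + e"] e(1) by auto
      then have "q \<in> V" using e(2)[of q] by (auto simp: dist_real_def)
      then show "\<exists>t\<in>\<rat>. ?P m t" using \<open>q \<in> \<rat>\<close> by (auto simp: V_def)
    qed
  }
  {
    assume "\<forall>m. \<exists>t\<in>\<rat>. ?P m t"
    then obtain t where t: "\<And>m. ?P m (t m)" by metis
    have bd: "t m \<in> {a - 1..b + 1}" for m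
    proof -
      have "1 / real (Suc m) \<le> 1" by simp
      then show ?thesis using t[of m] unfolding atLeastAtMost_iff by linarith
    qed
    then obtain t0 \<sigma> where \<sigma>: "strict_mono \<sigma>" "(t \<circ> \<sigma>) \<longlonglongrightarrow> t0"
      using compact_Icc[of "a - 1" "b + 1"] unfolding compact_def by blast
    have inv: "(\<lambda>k. 1 / real (Suc (\<sigma> k))) \<longlonglongrightarrow> 0"
      using LIMSEQ_subseq_LIMSEQ[OF LIMSEQ_inverse_real_of_nat \<sigma>(1)] by (simp add: o_def inverse_eq_divide)
    have "a - 0 \<le> t0"
      by (rule LIMSEQ_le[OF tendsto_diff[OF tendsto_const inv] \<sigma>(2)])
        (use t in \<open>auto intro!: exI[of _ 0] less_imp_le simp del: of_nat_Suc\<close>)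
    moreover have "t0 \<le> b + 0"
      by (rule LIMSEQ_le[OF \<sigma>(2) tendsto_add[OF tendsto_const inv]])
        (use t in \<open>auto intro!: exI[of _ 0] less_imp_le simp del: of_nat_Suc\<close>)
    moreover have "c i (T t0 x) = c i (R x)" for i
    proof -
      have "(\<lambda>k. c i (T (t (\<sigma> k)) x)) \<longlonglongrightarrow> c i (T t0 x)"
        using cont[of i] \<sigma>(2) unfolding continuous_on_sequentially by (auto simp: o_def)
      moreover have "(\<lambda>k. c i (T (t (\<sigma> k)) x) - c i (R x)) \<longlonglongrightarrow> 0"
      proof (rule tendsto_rabs_zero_cancel, rule tendsto_sandwich[OF _ _ tendsto_const inv])
        have "eventually (\<lambda>k. i < \<sigma> k) sequentially"
          using eventually_gt_at_top[of i] by eventually_elim (use seq_suble[OF \<sigma>(1)] less_le_trans in blast)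
        then show "eventually (\<lambda>k. \<bar>c i (T (t (\<sigma> k)) x) - c i (R x)\<bar> \<le> 1 / real (Suc (\<sigma> k))) sequentially"
          by eventually_elim (use t less_imp_le in blast)
      qed auto
      ultimately show ?thesis
        using LIMSEQ_unique[of _ "c i (T t0 x)" "c i (R x)"] by (simp add: LIM_zero_iff)
    qed
    then have "T t0 x = R x" using c x Rx by (simp add: orbit_coords_def)
    ultimately show "x \<in> orbit_set R a b" using x by (auto simp: orbit_set_def intro!: bexI[of _ t0])
  }
qed

lemma orbit_set_measurable:
  assumes c: "orbit_coords c" and R[measurable]: "R \<in> M \<rightarrow>\<^sub>M M"
  shows "orbit_set R a b \<in> sets M"
proof -
  have [measurable]: "c i \<in> borel_measurable M" for i using c by (simp add: orbit_coords_def)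
  have sub: "orbit_set R a b \<subseteq> space M" by (auto simp: orbit_set_def)
  have "orbit_set R a b = {x \<in> space M. \<forall>m. \<exists>t\<in>\<rat>. a - 1 / Suc m < t \<and> t < b + 1 / Suc m \<and>
      (\<forall>i<m. \<bar>c i (T t x) - c i (R x)\<bar> < 1 / Suc m)}"
    using orbit_set_iff[OF c R] sub by blast
  also have "\<dots> \<in> sets M"
    unfolding Rats_def bex_simps by measurable
  finally show ?thesis .
qed

text \<open>Since \<open>R\<close> commutes with the flow, the times carrying \<open>x\<close> to
  \<open>R x\<close> are also those carrying \<open>T t x\<close> to \<open>R (T t x)\<close>, so
  the set is invariant up to null sets.\<close>

lemma orbit_set_measure_0_1:
  assumes c: "orbit_coords c" and R[measurable]: "R \<in> M \<rightarrow>\<^sub>M M"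
    and comm: "\<And>t. AE x in M. R (T t x) = T t (R x)"
  shows "measure M (orbit_set R a b) = 0 \<or> measure M (orbit_set R a b) = 1"
proof (rule AE_invariant_measure_0_1[OF orbit_set_measurable[OF c R]])
  fix t
  show "AE x in M. T t x \<in> orbit_set R a b \<longleftrightarrow> x \<in> orbit_set R a b"
    using comm[of t] AE_space
  proof eventually_elim
    case (elim x)
    have "R (T t x) = T s (T t x) \<longleftrightarrow> R x = T s x" for s
      unfolding elim(1) T_commute[of s t] T_inject ..
    then show ?case using elim(2) by (simp add: orbit_set_def)
  qed
qed

text \<open>Each time interval gets measure 0 or 1. If arbitrarily small intervals around some
  \<open>t0\<close> had measure 1, \<open>R\<close> would be \<open>T t0\<close> almost everywhere.
  Otherwise bisection makes every bounded interval null, and countably many of them cover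
  \<open>G\<close>.\<close>

theorem AE_eq_flow_if_in_orbits:
  assumes c: "orbit_coords c" and R[measurable]: "R \<in> M \<rightarrow>\<^sub>M M"
    and comm: "\<And>t. AE x in M. R (T t x) = T t (R x)"
    and G: "G \<in> sets M" "0 < measure M G" and orb: "\<And>x. x \<in> G \<Longrightarrow> \<exists>t. R x = T t x"
  shows "\<exists>t. AE x in M. R x = T t x"
proof (rule ccontr)
  assume no: "\<not> ?thesis"
  let ?E = "orbit_set R"
  have E[measurable]: "?E a b \<in> sets M" for a b by (rule orbit_set_measurable[OF c R])
  have E01: "measure M (?E a b) = 0 \<or> measure M (?E a b) = 1" for a b
    by (rule orbit_set_measure_0_1[OF c R comm])
  have mono: "?E a b \<subseteq> ?E a' b'" if "a' \<le> a" "b \<le> b'" for a b a' b'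
    using that unfolding orbit_set_def by force
  have null: "measure M (?E a b) = 0" if "a \<le> b" for a b
    using that
  proof (induction rule: Bolzano)
    case (trans a b d)
    have "?E a d \<subseteq> ?E a b \<union> ?E b d" unfolding orbit_set_def by force
    then have "measure M (?E a d) \<le> measure M (?E a b \<union> ?E b d)" by (intro finite_measure_mono) auto
    also have "\<dots> \<le> measure M (?E a b) + measure M (?E b d)" by (intro measure_Un_le) auto
    finally show ?case using trans measure_nonneg[of M "?E a d"] by simp
  next
    case (local t0)
    show ?case
    proof (rule ccontr)
      assume ex: "\<not> ?thesis"
      have one: "measure M (?E (t0 - 1 / Suc n) (t0 + 1 / Suc n)) = 1" for n
      proof -
        have "(0::real) < 1 / Suc n" by simp
        with ex obtain u v where uv: "u \<le> t0" "t0 \<le> v" "v - u < 1 / Suc n" "measure M (?E u v) \<noteq> 0"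
          by blast
        have "measure M (?E u v) \<le> measure M (?E (t0 - 1 / Suc n) (t0 + 1 / Suc n))"
          using uv by (intro finite_measure_mono mono) (auto simp del: of_nat_Suc)
        then show ?thesis using E01[of "t0 - 1 / Suc n" "t0 + 1 / Suc n"] uv(4) measure_nonneg[of M "?E u v"] by linarith
      qed
      have "AE x in M. \<forall>n. x \<in> ?E (t0 - 1 / Suc n) (t0 + 1 / Suc n)"
        unfolding AE_all_countable by (intro allI AE_in_set_eq_1[THEN iffD2] one E)
      then have "AE x in M. R x = T t0 x"
        using AE_space
      proof eventually_elim
        case (elim x)
        have "\<forall>n. \<exists>t. \<bar>t - t0\<bar> \<le> 1 / Suc n \<and> R x = T t x"
        proof
          fix n
          from elim(1) obtain t where "t0 - 1 / Suc n \<le> t" "t \<le> t0 + 1 / Suc n" "R x = T t x"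
            unfolding orbit_set_def by fastforce
          then show "\<exists>t. \<bar>t - t0\<bar> \<le> 1 / Suc n \<and> R x = T t x"
            by (intro exI[of _ t] conjI) linarith+
        qed
        \<comment> \<open>The times may vary with \<open>n\<close>, yet they tend to
          \<open>t0\<close> and all give the same point \<open>R x\<close>; continuity of the
          coordinates carries this to the limit.\<close>
        then obtain t where t: "\<And>n. \<bar>t n - t0\<bar> \<le> 1 / Suc n" "\<And>n. R x = T (t n) x" by metis
        have "(\<lambda>n. t n - t0) \<longlonglongrightarrow> 0"
          by (rule tendsto_rabs_zero_cancel, rule tendsto_sandwich[OF _ _ tendsto_const LIMSEQ_inverse_real_of_nat])
            (use t in \<open>auto simp: inverse_eq_divide simp del: of_nat_Suc\<close>)
        then have "t \<longlonglongrightarrow> t0" by (simp add: LIM_zero_iff)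
        then have "(\<lambda>n. c i (T (t n) x)) \<longlonglongrightarrow> c i (T t0 x)" for i
          using c elim(2) unfolding orbit_coords_def continuous_on_sequentially by (auto simp: o_def)
        then have "c i (R x) = c i (T t0 x)" for i
          unfolding t(2)[symmetric] by (simp add: LIMSEQ_const_iff)
        then show ?case
          using c elim(2) measurable_space[OF R, of x] by (simp add: orbit_coords_def)
      qed
      with no show False by blast
    qed
  qed
  have "G \<subseteq> (\<Union>n::nat. ?E (- real n) (real n))"
  proof
    fix x assume x: "x \<in> G"
    then obtain t where t: "R x = T t x" using orb by blast
    obtain n :: nat where "\<bar>t\<bar> \<le> real n" using real_arch_simple by blast
    then show "x \<in> (\<Union>n::nat. ?E (- real n) (real n))"
      using t x sets.sets_into_space[OF G(1)] by (auto simp: orbit_set_def intro!: exI[of _ n] bexI[of _ t])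
  qed
  moreover have "(\<Union>n::nat. ?E (- real n) (real n)) \<in> null_sets M"
    by (intro null_sets_UN) (auto simp: null_sets_def emeasure_eq_measure null)
  ultimately have "G \<in> null_sets M" using G(1) null_sets_subset by blast
  with G(2) show False by (simp add: measure_eq_0_null_sets)
qed

end

section \<open>Rigidity from Ratner's property\<close>

text \<open>Each compact piece has finite nets of radius \<open>1 / Suc n\<close>. The sequence
  serves to make \<open>dist\<close> measurable and to separate points by countably many
  functions.\<close>

lemma sigma_compact_dense_sequence:
  fixes K :: "nat \<Rightarrow> 'b::metric_space set"
  assumes "\<And>i. compact (K i)" "(\<Union>i. K i) = UNIV"
  obtains D :: "nat \<Rightarrow> 'b" where "\<And>x e. 0 < e \<Longrightarrow> \<exists>n. dist x (D n) < e"
proof -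
  have "\<exists>k. finite k \<and> K i \<subseteq> (\<Union>x\<in>k. ball x (1 / Suc n))" for i n
    using assms(1)[of i] compact_eq_totally_bounded[of "K i"] by simp
  then obtain k where k: "\<And>i n. finite (k i n)" "\<And>i n. K i \<subseteq> (\<Union>x\<in>k i n. ball x (1 / Suc n))"
    by metis
  define Q where "Q = (\<Union>i n. k i n)"
  have Q: "countable Q" unfolding Q_def by (intro countable_UN countable_finite k(1) countableI_type)
  have dense: "\<exists>y\<in>Q. dist x y < e" if e: "0 < e" for x e
  proof -
    obtain n where n: "1 / real (Suc n) < e" using e nat_approx_posE by blast
    obtain i where "x \<in> K i" using assms(2) by blast
    then obtain y where "y \<in> k i n" "dist y x < 1 / Suc n" using k(2)[of i n] by auto
    then show ?thesis using n by (intro bexI[of _ y]) (auto simp: Q_def dist_commute)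
  qed
  then have "Q \<noteq> {}" using zero_less_one by blast
  show thesis
  proof
    fix x :: 'b and e :: real assume "0 < e"
    from dense[OF this] obtain y where "y \<in> Q" "dist x y < e" by blast
    then show "\<exists>n. dist x (from_nat_into Q n) < e"
      using from_nat_into_surj[OF Q] by metis
  qed
qed

text \<open>The type is not in the class \<open>second_countable_topology\<close>, so the library lemma
  \<open>borel_measurable_dist\<close> does not apply.\<close>
lemma borel_measurable_dist_dense:
  fixes f g :: "'a \<Rightarrow> 'b::metric_space" and D :: "nat \<Rightarrow> 'b"
  assumes D: "\<And>x e. 0 < e \<Longrightarrow> \<exists>n. dist x (D n) < e"
    and f[measurable]: "f \<in> borel_measurable K" and g[measurable]: "g \<in> borel_measurable K"
  shows "(\<lambda>x. dist (f x) (g x)) \<in> borel_measurable K"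
proof -
  have [measurable]: "(\<lambda>y. dist y z) \<in> borel_measurable borel" for z :: 'b
    by (intro borel_measurable_continuous_onI continuous_intros)
  \<comment> \<open>A strict inequality survives a detour through a close point of the dense
    sequence, which leaves a countable union of conditions on sums of one-point distances.\<close>
  have less: "dist x y < r \<longleftrightarrow> (\<exists>n. dist x (D n) + dist y (D n) < r)" for x y r
  proof
    assume "dist x y < r"
    then obtain n where "dist x (D n) < (r - dist x y) / 2" using D[of "(r - dist x y) / 2" x] by auto
    then have "dist x (D n) + dist y (D n) < r"
      using dist_triangle[of y "D n" x] by (simp add: dist_commute field_simps)
    then show "\<exists>n. dist x (D n) + dist y (D n) < r" ..
  next
    assume "\<exists>n. dist x (D n) + dist y (D n) < r"
    then show "dist x y < r" using dist_triangle2 le_less_trans by blast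
  qed
  show ?thesis
    unfolding borel_measurable_iff_less less by measurable
qed

text \<open>The sum over the window is the sum up to \<open>m + l + 1\<close> minus the sum up to
  \<open>m\<close>. For \<open>B\<close> the errors add up to
  \<open>(2 * m + l + 1) * \<tau>\<close>, for \<open>C\<close> an upper bound on the longer sum is
  enough. As \<open>m \<le> l / \<kappa>\<close>, both errors are a small multiple of
  \<open>l\<close>.\<close>

lemma window_count_less:
  fixes z :: "nat \<Rightarrow> 'b" and m l :: nat and a \<tau> c \<kappa> :: real
  assumes avg: "\<And>n. n \<ge> k \<Longrightarrow> \<bar>(\<Sum>i<n. indicator B (z i)) / real n - a\<bar> \<le> \<tau>"
    and C: "\<And>n. (\<Sum>i<n. indicator C (z i)) \<le> c * real n"
    and k: "0 < k" "k \<le> m" "k \<le> l" and \<kappa>: "0 < \<kappa>" "\<kappa> \<le> real l / real m"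
    and a: "0 \<le> a" "a \<le> 1/10" and \<tau>: "\<tau> * (2 / \<kappa> + 2) = 1/10" "0 < \<tau>" and c: "c * (1 / \<kappa> + 2) = 1/10" "0 < c"
  shows "real (card {n \<in> {m..m + l}. z n \<in> B \<or> z n \<in> C}) / real l < 9/10"
proof -
  have ml: "0 < real m" "1 \<le> real l" using k by auto
  have m_le: "real m \<le> real l * (1 / \<kappa>)" using \<kappa> ml by (simp add: field_simps)
  have sumB: "(\<Sum>i<n. indicator B (z i)) \<le> real n * (a + \<tau>)" "real n * (a - \<tau>) \<le> (\<Sum>i<n. indicator B (z i))"
    if "k \<le> n" for n
    using avg[OF that] that k(1) by (auto simp: abs_le_iff field_simps)
  have cardsum: "real (card {n \<in> {m..m + l}. z n \<in> A}) = (\<Sum>i\<in>{m..m + l}. indicator A (z i))" for A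
    by (simp add: indicator_def sum.If_cases Int_def of_bool_def)
  have split: "(\<Sum>i<m + l + 1. indicator A (z i)) = (\<Sum>i<m. indicator A (z i)) + (\<Sum>i\<in>{m..m + l}. indicator A (z i) :: real)" for A
  proof -
    have eq: "{..<m + l + 1} = {..<m} \<union> {m..m + l}" by auto
    show ?thesis by (subst eq, rule sum.union_disjoint) auto
  qed
  have nB: "real (card {n \<in> {m..m + l}. z n \<in> B}) \<le> (real l + 1) * a + (2 * real m + real l + 1) * \<tau>"
    using split[of B] sumB(1)[of "m + l + 1"] sumB(2)[of m] k cardsum[of B] by (simp add: algebra_simps)
  have nC: "real (card {n \<in> {m..m + l}. z n \<in> C}) \<le> c * (real m + real l + 1)"
  proof -
    have "0 \<le> (\<Sum>i<m. indicator C (z i) :: real)" by (intro sum_nonneg) auto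
    then show ?thesis using split[of C] C[of "m + l + 1"] cardsum[of C] by (simp add: algebra_simps)
  qed
  have "real (card {n \<in> {m..m + l}. z n \<in> B \<or> z n \<in> C})
      \<le> real (card ({n \<in> {m..m + l}. z n \<in> B} \<union> {n \<in> {m..m + l}. z n \<in> C}))"
    unfolding of_nat_le_iff by (rule card_mono) auto
  also have "\<dots> \<le> real (card {n \<in> {m..m + l}. z n \<in> B}) + real (card {n \<in> {m..m + l}. z n \<in> C})"
    unfolding of_nat_add[symmetric] of_nat_le_iff by (rule card_Un_le)
  also have "\<dots> \<le> (real l + 1) * a + (2 * real m + real l + 1) * \<tau> + c * (real m + real l + 1)"
    using nB nC by simp
  \<comment> \<open>The window has \<open>l + 1\<close> points; \<open>l + 1 \<le> 2 * l\<close>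
    turns the density 1/10 into 2/10. The defining equations of \<open>\<tau>\<close> and
    \<open>c\<close> give a tenth each, so the total is 4/10.\<close>
  also have "\<dots> \<le> real l * (2/10) + real l * (1/10) + real l * (1/10)"
  proof (intro add_mono)
    have "(real l + 1) * a \<le> (2 * real l) * (1/10)" using a ml by (intro mult_mono) auto
    then show "(real l + 1) * a \<le> real l * (2/10)" by simp
    have "real l * (2 / \<kappa> + 2) = 2 * (real l * (1 / \<kappa>)) + 2 * real l" by (simp add: algebra_simps)
    then have "2 * real m + real l + 1 \<le> real l * (2 / \<kappa> + 2)" using m_le ml by linarith
    then have "(2 * real m + real l + 1) * \<tau> \<le> (real l * (2 / \<kappa> + 2)) * \<tau>"
      using \<tau>(2) by (intro mult_right_mono) auto
    also have "\<dots> = real l * (1/10)" unfolding \<tau>(1)[symmetric] by (simp only: ac_simps)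
    finally show "(2 * real m + real l + 1) * \<tau> \<le> real l * (1/10)" .
    have "c * (real m + real l + 1) \<le> c * (real l * (1 / \<kappa> + 2))"
      using m_le ml c(2) by (intro mult_left_mono) (auto simp: algebra_simps)
    also have "\<dots> = real l * (1/10)" unfolding c(1)[symmetric] by (simp only: ac_simps)
    finally show "c * (real m + real l + 1) \<le> real l * (1/10)" .
  qed
  finally show ?thesis using ml by (simp add: field_simps)
qed


locale metric_flow = ergodic_mp_flow M T
  for M :: "'b::metric_space measure" and T +
  fixes D :: "nat \<Rightarrow> 'b"
  assumes sets_M: "sets M = sets borel" and D: "\<And>x e. 0 < e \<Longrightarrow> \<exists>n. dist x (D n) < e"
begin

lemma space_M [simp]: "space M = UNIV"
  using sets_eq_imp_space_eq[OF sets_M] by simp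

lemma measurable_M_iff: "f \<in> K \<rightarrow>\<^sub>M M \<longleftrightarrow> f \<in> borel_measurable K"
  using measurable_cong_sets[OF refl sets_M] by blast

lemma measurable_dist [measurable (raw)]:
  "f \<in> K \<rightarrow>\<^sub>M M \<Longrightarrow> g \<in> K \<rightarrow>\<^sub>M M \<Longrightarrow> (\<lambda>x. dist (f x) (g x)) \<in> borel_measurable K"
  unfolding measurable_M_iff by (rule borel_measurable_dist_dense[OF D])

text \<open>Truncated distances to the dense sequence are bounded and separate points.\<close>

lemma coords_exist:
  obtains c where "orbit_coords c"
proof (rule orbit_coords_exist[of "\<lambda>j x. min 1 (dist x (D j))"])
  fix x y assume eq: "\<And>j. min 1 (dist x (D j)) = min 1 (dist y (D j))"
  show "x = y"
  proof (rule ccontr)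
    assume "x \<noteq> y"
    then have "0 < min 1 (dist x y / 2)" by simp
    from D[OF this, of x] obtain j where j: "dist x (D j) < 1" "dist x (D j) < dist x y / 2" by auto
    with eq[of j] have "dist y (D j) = dist x (D j)" by (auto simp: min_def split: if_splits)
    then show False using j dist_triangle2[of x y "D j"] by simp
  qed
qed (auto intro!: borel_measurable_min measurable_dist)

lemma T_funpow: "(T t ^^ n) x = T (real n * t) x"
  by (induction n) (simp_all add: algebra_simps flip: T_add)

text \<open>As the radius shrinks, the sets decrease to the points fixed by some \<open>T p\<close>
  with \<open>p\<close> in the finite set \<open>P\<close>, which form a null set.\<close>

lemma near_return_set_small:
  assumes P: "finite P" "\<And>p. p \<in> P \<Longrightarrow> AE x in M. T p x \<noteq> x" and \<beta>: "0 < \<beta>"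
  obtains \<epsilon> where "0 < \<epsilon>" "\<epsilon> < \<beta>" "measure M {x. \<exists>p\<in>P. dist x (T p x) < 2 * \<epsilon>} < \<beta>"
proof -
  define B where "B n = {x \<in> space M. \<exists>p\<in>P. dist x (T p x) < 2 * (1 / Suc n)}" for n
  have B[measurable]: "B n \<in> sets M" for n
    unfolding B_def by (intro sets.sets_Collect_finite_Ex P(1)) measurable
  have "(\<lambda>n. measure M (B n)) \<longlonglongrightarrow> measure M (\<Inter>n. B n)"
  proof (rule finite_Lim_measure_decseq)
    have "1 / real (Suc n) \<le> 1 / real (Suc m)" if "m \<le> n" for m n
      using that by (intro divide_left_mono) auto
    then show "decseq B" unfolding decseq_def B_def by (force simp del: of_nat_Suc)
  qed auto
  also have "measure M (\<Inter>n. B n) = 0"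
  proof -
    have "AE x in M. \<forall>p\<in>P. T p x \<noteq> x" using P by (subst AE_finite_all) auto
    then have "AE x in M. x \<notin> (\<Inter>n. B n)"
    proof eventually_elim
      case (elim x)
      \<comment> \<open>The extra element 1 keeps the minimum meaningful when \<open>P\<close> is
        empty.\<close>
      define r where "r = Min (insert 1 ((\<lambda>p. dist x (T p x)) ` P))"
      have "0 < r" using elim P(1) by (auto simp: r_def)
      then obtain n where n: "1 / real (Suc n) < r / 2" using nat_approx_posE[of "r / 2"] by auto
      have "r \<le> dist x (T p x)" if "p \<in> P" for p using that P(1) by (auto simp: r_def)
      then have "x \<notin> B n" using n by (fastforce simp: B_def simp del: of_nat_Suc)
      then show ?case by blast
    qed
    then show ?thesis by (intro measure_eq_0_null_sets) (auto simp: AE_iff_null_sets)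
  qed
  finally have "eventually (\<lambda>n. measure M (B n) < \<beta>) sequentially"
    using \<beta> by (simp add: order_tendsto_iff)
  moreover have "eventually (\<lambda>n. 1 / real (Suc n) < \<beta>) sequentially"
    using LIMSEQ_inverse_real_of_nat \<beta> by (simp add: order_tendsto_iff inverse_eq_divide)
  ultimately have "eventually (\<lambda>n. measure M (B n) < \<beta> \<and> 1 / real (Suc n) < \<beta>) sequentially"
    by eventually_elim simp
  then obtain n where "measure M (B n) < \<beta>" "1 / real (Suc n) < \<beta>" by (auto simp: eventually_sequentially)
  then show thesis using that[of "1 / Suc n"] by (simp add: B_def)
qed

text \<open>For \<open>R\<close> close to the identity, Ratner's property applied to \<open>x\<close> and \<open>R x\<close> would make
  \<open>T (n * t0) x\<close> return close to its own \<open>T p\<close>-image for most \<open>n\<close> in a window. Birkhoff's theorem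
  excludes this uniformly in \<open>R\<close>; the error terms that depend on \<open>R\<close> are controlled by the maximal
  inequality alone, which is why \<open>\<eta>\<close> does not depend on \<open>R\<close>.\<close>
theorem R_property_rigidity:
  assumes Rp: "R_property M T t0 P" and P: "finite P" "\<And>p. p \<in> P \<Longrightarrow> AE x in M. T p x \<noteq> x"
  obtains \<eta> where "0 < \<eta>"
    "\<And>R. R \<in> measure_preserving M M \<Longrightarrow> (\<And>t. AE x in M. R (T t x) = T t (R x)) \<Longrightarrow>
      (\<And>p. p \<in> insert 0 P \<Longrightarrow> measure M {x. \<eta> \<le> dist (T p x) (T p (R x))} < \<eta>) \<Longrightarrow>
      \<exists>t. AE x in M. R x = T t x"
proof -
  interpret mp_system M "T t0" by standard (rule T_mp)
  obtain \<epsilon> where \<epsilon>: "0 < \<epsilon>" "\<epsilon> < 1/100" and mB: "measure M {x. \<exists>p\<in>P. dist x (T p x) < 2 * \<epsilon>} < 1/100"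
    using near_return_set_small[OF P, of "1/100"] by auto
  define B where "B = {x \<in> space M. \<exists>p\<in>P. dist x (T p x) < 2 * \<epsilon>}"
  have B[measurable]: "B \<in> sets M"
    unfolding B_def by (intro sets.sets_Collect_finite_Ex P(1)) measurable
  from Rp \<epsilon>(1) obtain \<kappa> where \<kappa>: "0 < \<kappa>" and R\<kappa>: "\<And>Nn. \<exists>\<delta>>0. \<exists>Z\<in>sets M. measure M Z > 1 - \<epsilon> \<and>
       (\<forall>x\<in>Z. \<forall>y\<in>Z. (\<not> (\<exists>t. x = T t y)) \<and> dist x y < \<delta> \<longrightarrow>
          (\<exists>M L :: nat. M \<ge> Nn \<and> L \<ge> Nn \<and> real L / real M \<ge> \<kappa> \<and>
             (\<exists>p\<in>P. real (card {n \<in> {M..M+L}. dist (T (real n * t0) x) (T (real n * t0 + p) y) < \<epsilon>})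
                        / real L > 1 - \<epsilon>)))"
    unfolding R_property_def by blast
  define \<tau> where "\<tau> = 1 / (10 * (2 / \<kappa> + 2))"
  define c where "c = 1 / (10 * (1 / \<kappa> + 2))"
  have "0 < 2 / \<kappa> + 2" "0 < 1 / \<kappa> + 2" using \<kappa> by (simp_all add: add_pos_pos)
  then have \<tau>: "\<tau> * (2 / \<kappa> + 2) = 1/10" "0 < \<tau>" and c: "c * (1 / \<kappa> + 2) = 1/10" "0 < c"
    by (simp_all add: \<tau>_def c_def)
  define f :: "'b \<Rightarrow> real" where "f = indicator B"
  have f: "f \<in> borel_measurable M" "\<And>x. 0 \<le> f x" "\<And>x. f x \<le> 1"
    by (auto simp: f_def indicator_def[abs_def])
  note f(1)[measurable]
  obtain k where k: "0 < k" and
    mA1: "measure M {x \<in> space M. \<exists>n\<ge>k. \<exists>m\<ge>k. \<tau> < \<bar>birkhoff_avg f n x - birkhoff_avg f m x\<bar>} < 1/10"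
    using birkhoff_uniform_Cauchy[OF f \<tau>(2), of "1/10"] by auto
  from R\<kappa>[of k] obtain \<delta> Z where \<delta>: "0 < \<delta>" and Z[measurable]: "Z \<in> sets M" and mZ: "1 - \<epsilon> < measure M Z"
    and RZ: "\<And>x y. x \<in> Z \<Longrightarrow> y \<in> Z \<Longrightarrow> \<not> (\<exists>t. x = T t y) \<Longrightarrow> dist x y < \<delta> \<Longrightarrow>
          (\<exists>M L :: nat. M \<ge> k \<and> L \<ge> k \<and> real L / real M \<ge> \<kappa> \<and>
             (\<exists>p\<in>P. real (card {n \<in> {M..M+L}. dist (T (real n * t0) x) (T (real n * t0 + p) y) < \<epsilon>})
                        / real L > 1 - \<epsilon>))"
    by blast
  \<comment> \<open>\<open>\<delta>\<close> makes Ratner's property applicable to \<open>x\<close>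
    and \<open>R x\<close>, \<open>\<epsilon>\<close> serves the triangle inequality, and the last
    bound gives the union over \<open>P\<close> measure at most \<open>c / 10\<close>. The added 1
    covers an empty \<open>P\<close>.\<close>
  define \<eta> where "\<eta> = min (min \<delta> \<epsilon>) (c / (10 * (real (card P) + 1)))"
  have \<eta>: "0 < \<eta>" "\<eta> \<le> \<delta>" "\<eta> \<le> \<epsilon>" and \<eta>c: "real (card P) * \<eta> \<le> c / 10"
  proof -
    show "0 < \<eta>" "\<eta> \<le> \<delta>" "\<eta> \<le> \<epsilon>" using \<delta> \<epsilon> c by (auto simp: \<eta>_def intro!: divide_pos_pos add_nonneg_pos)
    have "real (card P) * \<eta> \<le> (real (card P) + 1) * (c / (10 * (real (card P) + 1)))"
      using \<open>0 < \<eta>\<close> by (intro mult_mono) (auto simp: \<eta>_def)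
    also have "\<dots> = c / 10" by (simp add: field_simps)
    finally show "real (card P) * \<eta> \<le> c / 10" .
  qed
  have main: "\<exists>t. AE x in M. R x = T t x"
    if R: "R \<in> measure_preserving M M" and comm: "\<And>t. AE x in M. R (T t x) = T t (R x)"
      and close: "\<And>p. p \<in> insert 0 P \<Longrightarrow> measure M {x. \<eta> \<le> dist (T p x) (T p (R x))} < \<eta>" for R
  proof -
    have R_meas[measurable]: "R \<in> M \<rightarrow>\<^sub>M M" by (rule measure_preserving_measurable[OF R])
    define C where "C = {x \<in> space M. \<exists>p\<in>P. \<eta> \<le> dist (T p x) (T p (R x))}"
    have C[measurable]: "C \<in> sets M"
      unfolding C_def by (intro sets.sets_Collect_finite_Ex P(1)) measurable
    have "measure M C \<le> (\<Sum>p\<in>P. measure M {x \<in> space M. \<eta> \<le> dist (T p x) (T p (R x))})"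
    proof -
      have "C = (\<Union>p\<in>P. {x \<in> space M. \<eta> \<le> dist (T p x) (T p (R x))})" by (auto simp: C_def)
      also have "measure M \<dots> \<le> (\<Sum>p\<in>P. measure M {x \<in> space M. \<eta> \<le> dist (T p x) (T p (R x))})"
        by (rule measure_UNION_le[OF P(1)]) measurable
      finally show ?thesis .
    qed
    also have "\<dots> \<le> (\<Sum>p\<in>P. \<eta>)"
      using close by (intro sum_mono less_imp_le) simp
    also have "\<dots> \<le> c / 10" using \<eta>c by simp
    finally have mC: "measure M C \<le> c / 10" .
    \<comment> \<open>The bad sets \<open>A1\<close>, \<open>A2\<close>, \<open>A3\<close> cost a
      tenth each, \<open>A4\<close>, \<open>A5\<close>, \<open>A6\<close> a hundredth each and
      \<open>A7\<close> nothing, so a set of positive measure remains.\<close>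
    define A1 where "A1 = {x \<in> space M. \<exists>n\<ge>k. \<exists>m\<ge>k. \<tau> < \<bar>birkhoff_avg f n x - birkhoff_avg f m x\<bar>}"
    define A2 where "A2 = {x \<in> space M. 1/10 \<le> birkhoff_avg f k x}"
    define A3 where "A3 = {x \<in> space M. \<exists>n. c * real n < (\<Sum>i<n. indicator C ((T t0 ^^ i) x))}"
    define A4 where "A4 = {x \<in> space M. \<eta> \<le> dist x (R x)}"
    define A5 where "A5 = space M - Z"
    define A6 where "A6 = R -` A5 \<inter> space M"
    \<comment> \<open>Only the countably many times \<open>n * t0\<close> enter. Writing the failure
      of equality through \<open>dist\<close> gives measurability.\<close>
    define A7 where "A7 = {x \<in> space M. \<exists>n. dist (R (T (real n * t0) x)) (T (real n * t0) (R x)) \<noteq> 0}"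
    have A[measurable]: "A1 \<in> sets M" "A2 \<in> sets M" "A3 \<in> sets M" "A4 \<in> sets M" "A5 \<in> sets M" "A6 \<in> sets M" "A7 \<in> sets M"
      unfolding A1_def A2_def A3_def A4_def A5_def A6_def A7_def by measurable
    have m1: "measure M A1 < 1/10" unfolding A1_def by (rule mA1)
    \<comment> \<open>Markov's inequality: the average at time \<open>k\<close> has mean
      \<open>measure M B\<close>, which is below 1/100.\<close>
    have m2: "measure M A2 \<le> 1/10"
    proof -
      have "(1/10) * measure M A2 = (\<integral>x. (1/10) * indicator A2 x \<partial>M)" by simp
      also have "\<dots> \<le> (\<integral>x. birkhoff_avg f k x \<partial>M)"
      proof (rule integral_mono)
        show "integrable M (birkhoff_avg f k)"
          by (rule integrable_const_bound[of _ 1])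
            (auto simp: birkhoff_avg_bounds[OF f(2,3)] abs_of_nonneg)
        show "integrable M (\<lambda>x. 1/10 * indicat_real A2 x)"
          by (rule integrable_const_bound[of _ 1]) (auto simp: indicator_def)
      qed (auto simp: A2_def birkhoff_avg_bounds[OF f(2,3)] indicator_def)
      also have "\<dots> = measure M B" using birkhoff_avg_integral[OF f k] by (simp add: f_def)
      finally show ?thesis using mB by (simp add: B_def)
    qed
    have m3: "measure M A3 \<le> 1/10"
    proof -
      have "c * measure M A3 \<le> c * (1/10)"
        using maximal_inequality[OF C c(2)] mC by (simp add: A3_def)
      then show ?thesis using c(2) by simp
    qed
    have m4: "measure M A4 < 1/100" using close[of 0] \<eta> \<epsilon> by (simp add: A4_def)
    have m5: "measure M A5 < 1/100" using mZ \<epsilon> by (simp add: A5_def prob_compl[OF Z] del: space_M)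
    have m6: "measure M A6 < 1/100"
      unfolding A6_def using m5 measure_preserving_measure[OF R A(5)] by simp
    have m7: "measure M A7 = 0"
    proof -
      have "AE x in M. \<forall>n::nat. R (T (real n * t0) x) = T (real n * t0) (R x)"
        unfolding AE_all_countable using comm by blast
      then have "AE x in M. x \<notin> A7" by eventually_elim (simp add: A7_def)
      then show ?thesis by (intro measure_eq_0_null_sets) (auto simp: AE_iff_null_sets)
    qed
    define G where "G = space M - (A1 \<union> A2 \<union> A3 \<union> A4 \<union> A5 \<union> A6 \<union> A7)"
    have G: "G \<in> sets M" unfolding G_def by measurable
    have "measure M (A1 \<union> A2 \<union> A3 \<union> A4 \<union> A5 \<union> A6 \<union> A7)
        \<le> measure M A1 + measure M A2 + measure M A3 + measure M A4 + measure M A5 + measure M A6 + measure M A7"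
      by (intro measure_Un_le[THEN order_trans] add_right_mono sets.Un A order_refl)
    then have mG: "0 < measure M G"
      unfolding G_def using m1 m2 m3 m4 m5 m6 m7 by (subst prob_compl) auto
    have orbit: "\<exists>t. R x = T t x" if x: "x \<in> G" for x
    proof (rule ccontr)
      assume no: "\<not> ?thesis"
      have xs: "x \<notin> A1" "x \<notin> A2" "x \<notin> A3" "x \<notin> A4" "x \<in> Z" "R x \<in> Z" "x \<notin> A7"
        using x by (auto simp: G_def A5_def A6_def)
      have "\<not> (\<exists>t. x = T t (R x))" using no T_minus(1) by metis
      moreover have "dist x (R x) < \<delta>" using xs(4) \<eta> by (simp add: A4_def)
      ultimately obtain m l :: nat and p where ml: "k \<le> m" "k \<le> l" "\<kappa> \<le> real l / real m" and p: "p \<in> P"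
        and count: "1 - \<epsilon> < real (card {n \<in> {m..m+l}. dist (T (real n * t0) x) (T (real n * t0 + p) (R x)) < \<epsilon>}) / real l"
        using RZ[OF xs(5,6)] by blast
      define z where "z n = T (real n * t0) x" for n
      have "{n \<in> {m..m+l}. dist (T (real n * t0) x) (T (real n * t0 + p) (R x)) < \<epsilon>}
          \<subseteq> {n \<in> {m..m+l}. z n \<in> B \<or> z n \<in> C}"
      proof safe
        fix n assume d: "dist (T (real n * t0) x) (T (real n * t0 + p) (R x)) < \<epsilon>" and "z n \<notin> C"
        have "R (z n) = T (real n * t0) (R x)" using xs(7) by (simp add: A7_def z_def)
        then have "T (real n * t0 + p) (R x) = T p (R (z n))" by (metis T_add add.commute)
        then have "dist (z n) (T p (R (z n))) < \<epsilon>" using d by (simp add: z_def)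
        moreover have "dist (T p (z n)) (T p (R (z n))) < \<epsilon>"
          using \<open>z n \<notin> C\<close> p \<eta> by (force simp: C_def)
        ultimately have "dist (z n) (T p (z n)) < 2 * \<epsilon>"
          using dist_triangle2[of "z n" "T p (z n)" "T p (R (z n))"] by linarith
        then show "z n \<in> B" using p by (auto simp: B_def)
      qed
      then have "real (card {n \<in> {m..m+l}. dist (T (real n * t0) x) (T (real n * t0 + p) (R x)) < \<epsilon>})
          \<le> real (card {n \<in> {m..m+l}. z n \<in> B \<or> z n \<in> C})"
        unfolding of_nat_le_iff by (rule card_mono[rotated]) auto
      then have "real (card {n \<in> {m..m+l}. dist (T (real n * t0) x) (T (real n * t0 + p) (R x)) < \<epsilon>}) / real l
          \<le> real (card {n \<in> {m..m+l}. z n \<in> B \<or> z n \<in> C}) / real l"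
        by (rule divide_right_mono) simp
      \<comment> \<open>This contradicts \<open>count\<close>, whose lower bound
        \<open>1 - \<epsilon>\<close> exceeds 99/100.\<close>
      also have "\<dots> < 9/10"
      proof (rule window_count_less[OF _ _ k ml(1,2) \<kappa> ml(3) _ _ \<tau> c])
        show "0 \<le> birkhoff_avg f k x" by (rule birkhoff_avg_bounds[OF f(2,3)])
        show "birkhoff_avg f k x \<le> 1/10" using xs(2) by (simp add: A2_def)
        show "\<bar>(\<Sum>i<n. indicator B (z i)) / real n - birkhoff_avg f k x\<bar> \<le> \<tau>" if "n \<ge> k" for n
        proof -
          have "\<bar>birkhoff_avg f n x - birkhoff_avg f k x\<bar> \<le> \<tau>"
            using xs(1) that by (auto simp: A1_def not_less)
          then show ?thesis by (simp add: birkhoff_avg_def[of _ n] f_def T_funpow z_def)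
        qed
        show "(\<Sum>i<n. indicator C (z i)) \<le> c * real n" for n
          using xs(3) by (auto simp: A3_def T_funpow z_def not_less)
      qed
      finally show False using count \<epsilon> by linarith
    qed
    obtain co where "orbit_coords co" using coords_exist by blast
    from AE_eq_flow_if_in_orbits[OF this R_meas comm G mG orbit] show ?thesis .
  qed
  show thesis using that[OF \<eta>(1)] main by blast
qed

end

section \<open>Cosets in the centralizer\<close>

text \<open>The squared L2 distance between the compositions of the indicator of \<open>A\<close>
  with \<open>f\<close> and with \<open>g\<close>; the strong operator topology controls it
  directly.\<close>

definition mismatch :: "'a measure \<Rightarrow> ('a \<Rightarrow> 'b) \<Rightarrow> ('a \<Rightarrow> 'b) \<Rightarrow> 'b set \<Rightarrow> real" where
  "mismatch M f g A = measure M {x \<in> space M. (f x \<in> A) \<noteq> (g x \<in> A)}"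

lemma measure_preserving_measure_Collect:
  assumes "f \<in> measure_preserving M N" "Measurable.pred N Q"
  shows "measure N {y \<in> space N. Q y} = measure M {x \<in> space M. Q (f x)}"
proof -
  have "{x \<in> space M. Q (f x)} = f -` {y \<in> space N. Q y} \<inter> space M"
    using measurable_space[OF measure_preserving_measurable[OF assms(1)]] by auto
  then show ?thesis
    using measure_preserving_measure[OF assms(1), of "{y \<in> space N. Q y}"] assms(2) by simp
qed

context prob_space
begin

text \<open>Finitely many balls of radius \<open>\<eta> / 2\<close> capture \<open>u x\<close> up to
  probability \<open>\<eta> / 2\<close>. If \<open>x\<close> and \<open>R x\<close> lie in the
  preimage of the same ball, their images are closer than \<open>\<eta>\<close>; leaving a preimage
  is what \<open>mismatch\<close> measures. \<open>F\<close> and \<open>r\<close> are chosen before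
  \<open>R\<close>.\<close>

lemma closeness_test_sets:
  fixes u :: "'a \<Rightarrow> 'b::metric_space" and D :: "nat \<Rightarrow> 'b"
  assumes D: "\<And>x e. 0 < e \<Longrightarrow> \<exists>n. dist x (D n) < e"
    and u[measurable]: "u \<in> borel_measurable M" and \<eta>: "0 < \<eta>"
  shows "\<exists>F r. finite F \<and> F \<subseteq> sets M \<and> 0 < r \<and> (\<forall>R\<in>M \<rightarrow>\<^sub>M M. (\<forall>A\<in>F. mismatch M R id A < r) \<longrightarrow>
           measure M {x \<in> space M. \<eta> \<le> dist (u x) (u (R x))} < \<eta>)"
proof -
  have [measurable]: "(\<lambda>y. dist y z) \<in> borel_measurable borel" for z :: 'b
    by (intro borel_measurable_continuous_onI continuous_intros)
  define A where "A j = {x \<in> space M. dist (u x) (D j) < \<eta> / 2}" for j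
  have A[measurable]: "A j \<in> sets M" for j unfolding A_def by measurable
  have "(\<lambda>n. measure M (\<Union>j<n. A j)) \<longlonglongrightarrow> measure M (\<Union>n. \<Union>j<n. A j)"
    by (intro finite_Lim_measure_incseq) (auto simp: incseq_def intro: less_le_trans)
  also have "(\<Union>n. \<Union>j<n. A j) = space M"
    using D[of "\<eta> / 2"] \<eta> by (fastforce simp: A_def)
  finally have "eventually (\<lambda>n. 1 - \<eta> / 2 < measure M (\<Union>j<n. A j)) sequentially"
    using \<eta> by (simp add: order_tendsto_iff prob_space)
  then obtain n where n: "1 - \<eta> / 2 < measure M (\<Union>j<n. A j)" by (auto simp: eventually_sequentially)
  \<comment> \<open>The denominator makes \<open>n\<close> mismatches cost less than
    \<open>\<eta> / 2\<close> together; the added 1 keeps it positive and the bound strict.\<close>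
  define r where "r = \<eta> / (2 * (real n + 1))"
  have r: "0 < r" "real n * r < \<eta> / 2"
    using \<eta> by (simp_all add: r_def field_simps add_pos_pos)
  have "measure M {x \<in> space M. \<eta> \<le> dist (u x) (u (R x))} < \<eta>"
    if R[measurable]: "R \<in> M \<rightarrow>\<^sub>M M" and mis: "\<And>j. j < n \<Longrightarrow> mismatch M R id (A j) < r" for R
  proof -
    let ?X = "\<lambda>j. {x \<in> space M. (R x \<in> A j) \<noteq> (id x \<in> A j)}"
    have "{x \<in> space M. \<eta> \<le> dist (u x) (u (R x))} \<subseteq> (space M - (\<Union>j<n. A j)) \<union> (\<Union>j<n. ?X j)"
    proof safe
      fix x j assume "x \<in> space M" "\<eta> \<le> dist (u x) (u (R x))" "x \<notin> (\<Union>j<n. ?X j)" "j < n" "x \<in> A j"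
      then have "dist (u x) (D j) < \<eta> / 2" "dist (u (R x)) (D j) < \<eta> / 2" by (auto simp: A_def)
      with \<open>\<eta> \<le> dist (u x) (u (R x))\<close> show False
        using dist_triangle2[of "u x" "u (R x)" "D j"] by linarith
    qed
    then have "measure M {x \<in> space M. \<eta> \<le> dist (u x) (u (R x))}
        \<le> measure M ((space M - (\<Union>j<n. A j)) \<union> (\<Union>j<n. ?X j))"
      by (intro finite_measure_mono) measurable
    also have "\<dots> \<le> measure M (space M - (\<Union>j<n. A j)) + measure M (\<Union>j<n. ?X j)"
      by (rule measure_Un_le) measurable
    also have "measure M (\<Union>j<n. ?X j) \<le> (\<Sum>j<n. measure M (?X j))"
      by (rule measure_UNION_le) auto
    also have "\<dots> \<le> (\<Sum>j<n. r)"
      using mis by (intro sum_mono less_imp_le) (simp add: mismatch_def)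
    finally have "measure M {x \<in> space M. \<eta> \<le> dist (u x) (u (R x))}
        \<le> measure M (space M - (\<Union>j<n. A j)) + real n * r" by simp
    also have "measure M (space M - (\<Union>j<n. A j)) = 1 - measure M (\<Union>j<n. A j)"
      by (rule prob_compl) measurable
    finally show ?thesis using n r by linarith
  qed
  then show ?thesis
    using r(1) A by (intro exI[of _ "A ` {..<n}"] exI[of _ r]) auto
qed

lemma closeness_test_sets_finite:
  fixes u :: "'q \<Rightarrow> 'a \<Rightarrow> 'b::metric_space" and D :: "nat \<Rightarrow> 'b"
  assumes D: "\<And>x e. 0 < e \<Longrightarrow> \<exists>n. dist x (D n) < e"
    and u: "\<And>q. q \<in> Q \<Longrightarrow> u q \<in> borel_measurable M" and \<eta>: "0 < \<eta>" and Q: "finite Q"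
  shows "\<exists>F r. finite F \<and> F \<subseteq> sets M \<and> 0 < r \<and> (\<forall>R\<in>M \<rightarrow>\<^sub>M M. (\<forall>A\<in>F. mismatch M R id A < r) \<longrightarrow>
           (\<forall>q\<in>Q. measure M {x \<in> space M. \<eta> \<le> dist (u q x) (u q (R x))} < \<eta>))"
proof -
  have "\<forall>q\<in>Q. \<exists>F r. finite F \<and> F \<subseteq> sets M \<and> 0 < r \<and> (\<forall>R\<in>M \<rightarrow>\<^sub>M M. (\<forall>A\<in>F. mismatch M R id A < r) \<longrightarrow>
           measure M {x \<in> space M. \<eta> \<le> dist (u q x) (u q (R x))} < \<eta>)"
    using closeness_test_sets[OF D u \<eta>] by blast
  then obtain F r where F: "\<And>q. q \<in> Q \<Longrightarrow> finite (F q) \<and> F q \<subseteq> sets M \<and> 0 < r q \<and>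
      (\<forall>R\<in>M \<rightarrow>\<^sub>M M. (\<forall>A\<in>F q. mismatch M R id A < r q) \<longrightarrow>
           measure M {x \<in> space M. \<eta> \<le> dist (u q x) (u q (R x))} < \<eta>)"
    by metis
  define r0 where "r0 = Min (insert 1 (r ` Q))"
  have r0: "0 < r0" "\<And>q. q \<in> Q \<Longrightarrow> r0 \<le> r q" using F Q by (auto simp: r0_def)
  show ?thesis
  proof (intro exI conjI ballI impI)
    show "finite (\<Union>q\<in>Q. F q)" "(\<Union>q\<in>Q. F q) \<subseteq> sets M" "0 < r0" using F Q r0 by auto
    fix R q assume "R \<in> M \<rightarrow>\<^sub>M M" and mis: "\<forall>A\<in>(\<Union>q\<in>Q. F q). mismatch M R id A < r0" and q: "q \<in> Q"
    moreover have "\<forall>A\<in>F q. mismatch M R id A < r q" using mis q r0(2)[OF q] less_le_trans by blast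
    ultimately show "measure M {x \<in> space M. \<eta> \<le> dist (u q x) (u q (R x))} < \<eta>" using F[OF q] by blast
  qed
qed

end

text \<open>Outer regularity replaces \<open>B\<close> by an open set at cost \<open>e / 2\<close>,
  and that set is exhausted by finite unions of basic sets at cost \<open>e / 2\<close>.\<close>

lemma measure_algebra_separable:
  fixes M :: "'a::polish_space measure"
  assumes "finite_measure M" and sets_M: "sets M = sets borel"
  obtains \<A> where "countable \<A>" "\<A> \<subseteq> sets M"
    "\<And>B e. B \<in> sets M \<Longrightarrow> 0 < e \<Longrightarrow> \<exists>A\<in>\<A>. measure M {x. (x \<in> B) \<noteq> (x \<in> A)} < e"
proof -
  interpret finite_measure M by fact
  obtain \<B> :: "'a set set" where \<B>: "countable \<B>" "topological_basis \<B>"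
    using ex_countable_basis by blast
  have \<B>_sets: "U \<in> sets M" if "U \<in> insert {} \<B>" for U
    using that topological_basis_open[OF \<B>(2)] by (auto simp: sets_M)
  define \<A> where "\<A> = Union ` {F. finite F \<and> F \<subseteq> insert {} \<B>}"
  show thesis
  proof
    show "countable \<A>" unfolding \<A>_def using \<B>(1) by (intro countable_image countable_Collect_finite_subset) simp
    show "\<A> \<subseteq> sets M" unfolding \<A>_def using \<B>_sets by (auto intro!: sets.finite_Union)
    fix B and e :: real assume B[measurable]: "B \<in> sets M" and e: "0 < e"
    have eq: "emeasure M B = (INF U \<in> {U. B \<subseteq> U \<and> open U}. emeasure M U)"
      using B by (intro outer_regular sets_M) (auto simp: sets_M emeasure_finite)
    have "emeasure M B < emeasure M B + ennreal (e / 2)"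
      using e by (simp add: emeasure_eq_measure ennreal_plus[symmetric] ennreal_less_iff del: ennreal_plus)
    then have "(INF U \<in> {U. B \<subseteq> U \<and> open U}. emeasure M U) < emeasure M B + ennreal (e / 2)"
      using eq by (rule subst[rotated])
    then obtain U where U: "B \<subseteq> U" "open U" "emeasure M U < emeasure M B + ennreal (e / 2)"
      unfolding INF_less_iff by blast
    have [measurable]: "U \<in> sets M" using U(2) by (simp add: sets_M)
    have mU: "measure M U < measure M B + e / 2"
      using U(3) e by (simp add: emeasure_eq_measure ennreal_plus[symmetric] ennreal_less_iff del: ennreal_plus)
    obtain \<B>' where \<B>': "\<B>' \<subseteq> \<B>" "U = \<Union>\<B>'"
      using \<B>(2) U(2) unfolding topological_basis_def by blast
    \<comment> \<open>The inserted empty set allows the enumeration even when no basic set occurs,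
      that is, for empty \<open>U\<close>.\<close>
    define V where "V = from_nat_into (insert {} \<B>')"
    have range_V: "range V = insert {} \<B>'"
      unfolding V_def using \<B>' \<B>(1) by (intro range_from_nat_into) (auto intro: countable_subset)
    have V[measurable]: "V i \<in> sets M" for i
      using \<B>_sets range_V \<B>'(1) by (metis insert_iff rangeI subset_iff)
    have "(\<lambda>n. measure M (\<Union>i<n. V i)) \<longlonglongrightarrow> measure M (\<Union>n. \<Union>i<n. V i)"
      by (intro finite_Lim_measure_incseq) (auto simp: incseq_def intro: less_le_trans)
    also have "(\<Union>n. \<Union>i<n. V i) = (\<Union>i. V i)" by auto
    also have "\<dots> = U" unfolding range_V \<B>'(2) by auto
    finally have "eventually (\<lambda>n. measure M U - e / 2 < measure M (\<Union>i<n. V i)) sequentially"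
      using e by (simp add: order_tendsto_iff)
    then obtain n where n: "measure M U - e / 2 < measure M (\<Union>i<n. V i)" by (auto simp: eventually_sequentially)
    let ?A = "\<Union>i<n. V i"
    have AU: "?A \<subseteq> U" using range_V \<B>'(2) by auto
    have "?A \<in> \<A>"
      unfolding \<A>_def using range_V \<B>'(1) by (intro image_eqI[of _ _ "V ` {..<n}"]) auto
    moreover have "measure M {x. (x \<in> B) \<noteq> (x \<in> ?A)} < e"
    proof -
      have "{x. (x \<in> B) \<noteq> (x \<in> ?A)} \<subseteq> (U - B) \<union> (U - ?A)" using U(1) AU by auto
      then have "measure M {x. (x \<in> B) \<noteq> (x \<in> ?A)} \<le> measure M ((U - B) \<union> (U - ?A))"
        by (intro finite_measure_mono) auto
      also have "\<dots> \<le> measure M (U - B) + measure M (U - ?A)" by (intro measure_Un_le) auto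
      also have "\<dots> = (measure M U - measure M B) + (measure M U - measure M ?A)"
        using U(1) AU by (subst (1 2) finite_measure_Diff) auto
      finally show ?thesis using mU n by linarith
    qed
    ultimately show "\<exists>A\<in>\<A>. measure M {x. (x \<in> B) \<noteq> (x \<in> A)} < e" by blast
  qed
qed

section \<open>Inverses and transfer to the metric model\<close>

lemma aut_inverse:
  assumes "S \<in> aut M"
  obtains S' where "S' \<in> measure_preserving M M" "AE x in M. S' (S x) = x" "AE x in M. S (S' x) = x"
  using assms by (auto simp: aut_def)

lemma centralizerD:
  assumes "S \<in> centralizer M T"
  shows "S \<in> aut M" "S \<in> measure_preserving M M" "AE x in M. S (T t x) = T t (S x)"
  using assms by (auto simp: centralizer_def aut_def)

text \<open>The relation is pulled back along \<open>\<psi>\<close> and the inverse applied to both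
  sides. It serves for the isomorphism onto the model and, with \<open>N = M\<close>, for the
  inverse of an element of the centralizer.\<close>

lemma flow_iso_commute_inverse:
  assumes T: "\<And>t. T t \<in> measure_preserving M M"
    and \<phi>: "\<phi> \<in> measure_preserving M N" and \<psi>: "\<psi> \<in> measure_preserving N M"
    and inv: "AE x in M. \<psi> (\<phi> x) = x" "AE y in N. \<phi> (\<psi> y) = y"
    and comm: "AE x in M. \<phi> (T t x) = S t (\<phi> x)"
  shows "AE y in N. \<psi> (S t y) = T t (\<psi> y)"
proof -
  have "AE y in N. \<phi> (T t (\<psi> y)) = S t (\<phi> (\<psi> y))"
    using AE_measure_preserving[OF \<psi> comm] .
  moreover have "AE y in N. \<psi> (\<phi> (T t (\<psi> y))) = T t (\<psi> y)"
    using AE_measure_preserving[OF measure_preserving_comp[OF \<psi> T] inv(1)] by simp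
  ultimately show ?thesis using inv(2) by eventually_elim metis
qed

text \<open>\<open>F\<close> and \<open>r\<close> do not depend on \<open>S1, S2\<close>: cosets are therefore open and, the measure algebra
  being separable, countable in number.\<close>
proposition coset_test_sets:
  fixes M :: "'a measure" and N :: "'b::metric_space measure"
  assumes M: "prob_space M" and flow: "measurable_flow M T" and free: "free_flow M T"
    and ratner: "ratner_metric N S" and iso: "flow_iso M T N S"
  obtains F r where "finite F" "F \<subseteq> sets M" "0 < r"
    "\<And>S1 S2. S1 \<in> centralizer M T \<Longrightarrow> S2 \<in> centralizer M T \<Longrightarrow>
       (\<And>A. A \<in> F \<Longrightarrow> mismatch M S1 S2 A < r) \<Longrightarrow> \<exists>t. AE x in M. S1 x = T t (S2 x)"
proof -
  interpret prob_space M by (rule M)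
  have T_mp: "T t \<in> measure_preserving M M" for t
    using flow by (simp add: measurable_flow_def)
  note [measurable] = measure_preserving_measurable[OF T_mp]
  from ratner obtain K :: "nat \<Rightarrow> 'b set" where K: "\<And>i. compact (K i)" "(\<Union>i. K i) = UNIV"
    and N: "prob_space N" "sets N = sets borel" "measurable_flow N S" "ergodic_flow N S"
    by (auto simp: ratner_metric_def metric_model_def)
  obtain D :: "nat \<Rightarrow> 'b" where D: "\<And>x e. 0 < e \<Longrightarrow> \<exists>n. dist x (D n) < e"
    using sigma_compact_dense_sequence[OF K] by blast
  interpret N: metric_flow N S D
    using N D by (intro metric_flow.intro ergodic_mp_flow.intro ergodic_mp_flow_axioms.intro metric_flow_axioms.intro)
  note [measurable] = measure_preserving_measurable[OF N.T_mp]
  from ratner obtain P where P: "finite P" "0 \<notin> P" "uncountable {s. s \<noteq> 0 \<and> R_property N S s P}"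
    by (auto simp: ratner_metric_def)
  then have "{s. s \<noteq> 0 \<and> R_property N S s P} \<noteq> {}" by (metis countable_empty)
  then obtain t0 where t0: "R_property N S t0 P" by blast
  from iso obtain \<phi> \<psi> where \<phi>: "\<phi> \<in> measure_preserving M N" and \<psi>: "\<psi> \<in> measure_preserving N M"
    and inv: "AE x in M. \<psi> (\<phi> x) = x" "AE y in N. \<phi> (\<psi> y) = y"
    and comm: "\<And>t. AE x in M. \<phi> (T t x) = S t (\<phi> x)"
    by (auto simp: flow_iso_def)
  note [measurable] = measure_preserving_measurable[OF \<phi>] measure_preserving_measurable[OF \<psi>]
  note comp = measure_preserving_comp
  have comm': "AE y in N. \<psi> (S t y) = T t (\<psi> y)" for t
    by (rule flow_iso_commute_inverse[OF T_mp \<phi> \<psi> inv comm])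
  have free_N: "AE y in N. S p y \<noteq> y" if "p \<in> P" for p
  proof -
    have "p \<noteq> 0" using that P(2) by blast
    have "AE x in M. T p x \<noteq> x"
      using free unfolding free_flow_def by eventually_elim (use \<open>p \<noteq> 0\<close> in blast)
    then have "AE y in N. T p (\<psi> y) \<noteq> \<psi> y" using AE_measure_preserving[OF \<psi>] by blast
    then show ?thesis using comm'[of p] by eventually_elim metis
  qed
  obtain \<eta> where \<eta>: "0 < \<eta>" and rigid:
    "\<And>R. R \<in> measure_preserving N N \<Longrightarrow> (\<And>t. AE y in N. R (S t y) = S t (R y)) \<Longrightarrow>
      (\<And>p. p \<in> insert 0 P \<Longrightarrow> measure N {y. \<eta> \<le> dist (S p y) (S p (R y))} < \<eta>) \<Longrightarrow>
      \<exists>t. AE y in N. R y = S t y"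
    using N.R_property_rigidity[OF t0 P(1) free_N] by blast
  \<comment> \<open>Composition with \<open>\<phi>\<close> expresses closeness in the metric model
    by test sets in \<open>M\<close>.\<close>
  have u: "(\<lambda>x. S p (\<phi> x)) \<in> borel_measurable M" for p
    unfolding N.measurable_M_iff[symmetric] by measurable
  have "\<exists>F r. finite F \<and> F \<subseteq> sets M \<and> 0 < r \<and> (\<forall>R\<in>M \<rightarrow>\<^sub>M M. (\<forall>A\<in>F. mismatch M R id A < r) \<longrightarrow>
      (\<forall>p\<in>insert 0 P. measure M {x \<in> space M. \<eta> \<le> dist (S p (\<phi> x)) (S p (\<phi> (R x)))} < \<eta>))"
    by (rule closeness_test_sets_finite[OF _ u \<eta> finite.insertI[OF P(1)]]) (rule D)
  then obtain F r where F: "finite F" "F \<subseteq> sets M" "0 < r" and test: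
    "\<forall>R\<in>M \<rightarrow>\<^sub>M M. (\<forall>A\<in>F. mismatch M R id A < r) \<longrightarrow>
      (\<forall>p\<in>insert 0 P. measure M {x \<in> space M. \<eta> \<le> dist (S p (\<phi> x)) (S p (\<phi> (R x)))} < \<eta>)"
    by (elim exE conjE)
  have "\<exists>t. AE x in M. S1 x = T t (S2 x)"
    if S1: "S1 \<in> centralizer M T" and S2: "S2 \<in> centralizer M T"
      and mis: "\<And>A. A \<in> F \<Longrightarrow> mismatch M S1 S2 A < r" for S1 S2
  proof -
    note S1_mp = centralizerD(2)[OF S1] and S2_mp = centralizerD(2)[OF S2]
    obtain S2' where S2'_mp: "S2' \<in> measure_preserving M M"
      and S2': "AE x in M. S2' (S2 x) = x" "AE x in M. S2 (S2' x) = x"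
      using aut_inverse[OF centralizerD(1)[OF S2]] by blast
    note [measurable] = S1_mp[THEN measure_preserving_measurable] S2_mp[THEN measure_preserving_measurable]
      S2'_mp[THEN measure_preserving_measurable]
    have S2'_comm: "AE x in M. S2' (T t x) = T t (S2' x)" for t
      by (rule flow_iso_commute_inverse[OF T_mp S2_mp S2'_mp S2' centralizerD(3)[OF S2]])
    \<comment> \<open>Two elements lie in one coset when their quotient is a time of the flow; this
      quotient, conjugated to the model as \<open>RN\<close>, is the map to which rigidity
      applies.\<close>
    define R where "R x = S1 (S2' x)" for x
    have R_mp: "R \<in> measure_preserving M M"
      using comp[OF S2'_mp S1_mp] by (simp add: R_def[abs_def] o_def)
    note [measurable] = R_mp[THEN measure_preserving_measurable]
    have R_comm: "AE x in M. R (T t x) = T t (R x)" for t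
      using S2'_comm[of t] AE_measure_preserving[OF S2'_mp centralizerD(3)[OF S1, of t]]
      by eventually_elim (simp add: R_def)
    define RN where "RN y = \<phi> (R (\<psi> y))" for y
    have RN_mp: "RN \<in> measure_preserving N N"
      using comp[OF comp[OF \<psi> R_mp] \<phi>] by (simp add: RN_def[abs_def] o_def)
    note [measurable] = RN_mp[THEN measure_preserving_measurable]
    have RN_comm: "AE y in N. RN (S t y) = S t (RN y)" for t
      using comm'[of t] AE_measure_preserving[OF \<psi> R_comm[of t]]
        AE_measure_preserving[OF comp[OF \<psi> R_mp] comm[of t]]
      by eventually_elim (simp add: RN_def)
    have mis_R: "mismatch M R id A < r" if A: "A \<in> F" for A
    proof -
      have [measurable]: "A \<in> sets M" using A F(2) by blast
      \<comment> \<open>Substituting \<open>S2 x\<close> for the variable preserves the measure and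
        cancels the inverse.\<close>
      have "mismatch M R id A = measure M {x \<in> space M. (R (S2 x) \<in> A) \<noteq> (S2 x \<in> A)}"
        unfolding mismatch_def id_apply by (rule measure_preserving_measure_Collect[OF S2_mp]) measurable
      also have "\<dots> = mismatch M S1 S2 A"
        unfolding mismatch_def
      proof (rule finite_measure_eq_AE)
        show "AE x in M. x \<in> {x \<in> space M. (R (S2 x) \<in> A) \<noteq> (S2 x \<in> A)} \<longleftrightarrow>
            x \<in> {x \<in> space M. (S1 x \<in> A) \<noteq> (S2 x \<in> A)}"
          using S2'(1) by eventually_elim (simp add: R_def)
      qed measurable
      finally show ?thesis using mis[OF A] by simp
    qed
    have close: "measure N {y. \<eta> \<le> dist (S p y) (S p (RN y))} < \<eta>" if p: "p \<in> insert 0 P" for p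
    proof -
      have "measure N {y. \<eta> \<le> dist (S p y) (S p (RN y))} = measure N {y \<in> space N. \<eta> \<le> dist (S p y) (S p (RN y))}"
        by simp
      also have "\<dots> = measure M {x \<in> space M. \<eta> \<le> dist (S p (\<phi> x)) (S p (RN (\<phi> x)))}"
        by (rule measure_preserving_measure_Collect[OF \<phi>]) measurable
      also have "\<dots> = measure M {x \<in> space M. \<eta> \<le> dist (S p (\<phi> x)) (S p (\<phi> (R x)))}"
      proof (rule finite_measure_eq_AE)
        show "AE x in M. x \<in> {x \<in> space M. \<eta> \<le> dist (S p (\<phi> x)) (S p (RN (\<phi> x)))} \<longleftrightarrow>
            x \<in> {x \<in> space M. \<eta> \<le> dist (S p (\<phi> x)) (S p (\<phi> (R x)))}"
          using inv(1) by eventually_elim (simp add: RN_def)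
      qed measurable
      also have "\<dots> < \<eta>"
        using test mis_R p measure_preserving_measurable[OF R_mp] by blast
      finally show ?thesis .
    qed
    obtain t where t: "AE y in N. RN y = S t y"
      using rigid[OF RN_mp RN_comm close] by blast
    have "AE x in M. RN (\<phi> (S2 x)) = S t (\<phi> (S2 x))"
      using AE_measure_preserving[OF comp[OF S2_mp \<phi>] t] by simp
    moreover have "AE x in M. \<phi> (T t (S2 x)) = S t (\<phi> (S2 x))" "AE x in M. \<psi> (\<phi> (S2 x)) = S2 x"
      using AE_measure_preserving[OF S2_mp comm[of t]] AE_measure_preserving[OF S2_mp inv(1)] .
    moreover have "AE x in M. \<psi> (\<phi> (S1 x)) = S1 x" "AE x in M. \<psi> (\<phi> (T t (S2 x))) = T t (S2 x)"
      using AE_measure_preserving[OF S1_mp inv(1)] AE_measure_preserving[OF comp[OF S2_mp T_mp[of t]] inv(1)]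
      by simp_all
    ultimately have "AE x in M. S1 x = T t (S2 x)"
      using S2'(1)
    \<comment> \<open>The identity is first obtained after \<open>\<phi>\<close>; its almost
      everywhere left inverse \<open>\<psi>\<close> removes \<open>\<phi>\<close> from both
      sides.\<close>
    proof eventually_elim
      case (elim x)
      have "\<phi> (S1 x) = RN (\<phi> (S2 x))" using elim by (simp add: RN_def R_def)
      also have "\<dots> = \<phi> (T t (S2 x))" using elim by simp
      finally show ?case using elim by metis
    qed
    then show ?thesis ..
  qed
  then show thesis using that F by blast
qed

section \<open>Cosets and the strong operator topology\<close>

lemma ec_class_eq_iff:
  assumes flow: "measurable_flow M T" and S1: "S1 \<in> centralizer M T" and S2: "S2 \<in> centralizer M T"
  shows "ec_class M T S1 = ec_class M T S2 \<longleftrightarrow> (\<exists>t. AE x in M. S1 x = T t (S2 x))"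
proof
  have T0: "T 0 x = x" and T_add: "T (s + t) x = T s (T t x)" for s t x
    using flow by (auto simp: measurable_flow_def)
  {
    assume eq: "ec_class M T S1 = ec_class M T S2"
    have "S1 \<in> ec_class M T S1" using S1 by (auto simp: ec_class_def T0 intro!: exI[of _ 0])
    then show "\<exists>t. AE x in M. S1 x = T t (S2 x)" unfolding eq by (auto simp: ec_class_def)
  }
  {
    assume "\<exists>t. AE x in M. S1 x = T t (S2 x)"
    then obtain t where t: "AE x in M. S1 x = T t (S2 x)" ..
    have "(\<exists>s. AE x in M. R x = T s (S1 x)) \<longleftrightarrow> (\<exists>s. AE x in M. R x = T s (S2 x))" for R
    proof safe
      fix s assume "AE x in M. R x = T s (S1 x)"
      with t have "AE x in M. R x = T (s + t) (S2 x)" by eventually_elim (simp add: T_add)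
      then show "\<exists>s. AE x in M. R x = T s (S2 x)" ..
    next
      fix s assume "AE x in M. R x = T s (S2 x)"
      with t have "AE x in M. R x = T (s - t) (S1 x)"
        by eventually_elim (simp flip: T_add)
      then show "\<exists>s. AE x in M. R x = T s (S1 x)" ..
    qed
    then show "ec_class M T S1 = ec_class M T S2" by (simp add: ec_class_def)
  }
qed

text \<open>For \<open>f\<close> the indicator of \<open>A\<close> the squared difference in the
  definition of \<open>sot\<close> is itself an indicator, so its integral is the mismatch and the
  set is a subbasic one.\<close>

lemma openin_sot_mismatch:
  assumes M: "prob_space M" and A[measurable]: "A \<in> sets M" and S: "S \<in> aut M" and r: "0 < r"
  shows "openin (sot M) {S' \<in> aut M. mismatch M S' S A < r}"
proof -
  interpret prob_space M by (rule M)
  define f :: "'a \<Rightarrow> complex" where "f = indicator A"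
  have "(\<integral>\<^sup>+x. ennreal ((cmod (f x))\<^sup>2) \<partial>M) = (\<integral>\<^sup>+x. indicator A x \<partial>M)"
    by (intro nn_integral_cong) (auto simp: f_def indicator_def)
  also have "\<dots> < \<infinity>" by (simp add: less_top[symmetric])
  finally have f: "f \<in> L2fun M" by (simp add: L2fun_def f_def)
  have eq: "(\<integral>\<^sup>+ x. ennreal ((cmod (f (S' x) - f (S x)))\<^sup>2) \<partial>M) = ennreal (mismatch M S' S A)"
    if S': "S' \<in> aut M" for S'
  proof -
    have [measurable]: "S \<in> M \<rightarrow>\<^sub>M M" "S' \<in> M \<rightarrow>\<^sub>M M"
      using S S' by (auto simp: aut_def measure_preserving_def)
    have "(\<integral>\<^sup>+ x. ennreal ((cmod (f (S' x) - f (S x)))\<^sup>2) \<partial>M)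
        = (\<integral>\<^sup>+ x. indicator {x \<in> space M. (S' x \<in> A) \<noteq> (S x \<in> A)} x \<partial>M)"
      by (intro nn_integral_cong) (auto simp: f_def indicator_def)
    also have "\<dots> = emeasure M {x \<in> space M. (S' x \<in> A) \<noteq> (S x \<in> A)}" by (intro nn_integral_indicator) measurable
    finally show ?thesis by (simp add: mismatch_def emeasure_eq_measure)
  qed
  have "{S' \<in> aut M. mismatch M S' S A < r}
      = {S' \<in> aut M. (\<integral>\<^sup>+ x. ennreal ((cmod (f (S' x) - f (S x)))\<^sup>2) \<partial>M) < ennreal r}"
    using eq by (auto simp: ennreal_less_iff mismatch_def)
  then show ?thesis
    unfolding sot_def using f S r by (intro topology_generated_by_Basis) blast
qed

lemma topspace_sot:
  assumes "prob_space M"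
  shows "topspace (sot M) = aut M"
proof
  show "topspace (sot M) \<subseteq> aut M" unfolding sot_def topology_generated_by_topspace by blast
  show "aut M \<subseteq> topspace (sot M)"
  proof
    fix S assume S: "S \<in> aut M"
    have "openin (sot M) {S' \<in> aut M. mismatch M S' S {} < 1}"
      by (rule openin_sot_mismatch[OF assms _ S]) auto
    from openin_subset[OF this] S show "S \<in> topspace (sot M)" by (auto simp: mismatch_def)
  qed
qed

text \<open>The test sets give every element of the centralizer a neighbourhood inside its own
  coset, so any union of cosets is open: the quotient topology is discrete. For countability, the
  preimages of the test sets are approximated in a countable part of the measure algebra.\<close>

theorem theorem1p1:
  fixes M :: "'a::polish_space measure" and T :: "real \<Rightarrow> 'a \<Rightarrow> 'a"
    and N :: "'b::metric_space measure" and S :: "real \<Rightarrow> 'b \<Rightarrow> 'b"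
  assumes "prob_space M" and "sets M = sets borel"
    and "measurable_flow M T" and "free_flow M T" and "ergodic_flow M T"
    and "ratner_metric N S" and "flow_iso M T N S"
  shows "countable (EC M T) \<and>
         quotient_map (subtopology (sot M) (centralizer M T)) (discrete_topology (EC M T))
                      (ec_class M T)"
proof
  interpret prob_space M by fact
  let ?C = "centralizer M T" and ?q = "ec_class M T"
  have space_M [simp]: "space M = UNIV" using sets_eq_imp_space_eq[OF assms(2)] by simp
  obtain F r where F: "finite F" "F \<subseteq> sets M" "0 < r" and test:
    "\<And>S1 S2. S1 \<in> ?C \<Longrightarrow> S2 \<in> ?C \<Longrightarrow> (\<And>A. A \<in> F \<Longrightarrow> mismatch M S1 S2 A < r) \<Longrightarrow>
       \<exists>t. AE x in M. S1 x = T t (S2 x)"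
    using coset_test_sets[OF assms(1,3,4,6,7)] by blast
  have q_eq: "?q S1 = ?q S2" if "S1 \<in> ?C" "S2 \<in> ?C" "\<And>A. A \<in> F \<Longrightarrow> mismatch M S1 S2 A < r" for S1 S2
    using ec_class_eq_iff[OF assms(3) that(1,2)] test[OF that] by simp
  have C_meas: "S1 \<in> M \<rightarrow>\<^sub>M M" if "S1 \<in> ?C" for S1
    using centralizerD(2)[OF that] by (rule measure_preserving_measurable)
  show "countable (EC M T)"
  proof -
    obtain \<A> where \<A>: "countable \<A>" "\<A> \<subseteq> sets M"
      "\<And>B e. B \<in> sets M \<Longrightarrow> 0 < e \<Longrightarrow> \<exists>A\<in>\<A>. measure M {x. (x \<in> B) \<noteq> (x \<in> A)} < e"
      using measure_algebra_separable[OF finite_measure_axioms assms(2)] by blast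
    \<comment> \<open>Such a \<open>g\<close> is a code for \<open>S1\<close>. Errors
      \<open>r / 2\<close> on both sides make equal codes imply a mismatch below \<open>r\<close>,
      hence equal cosets.\<close>
    have "\<exists>g\<in>F \<rightarrow>\<^sub>E \<A>. \<forall>A\<in>F. measure M {x. (S1 x \<in> A) \<noteq> (x \<in> g A)} < r / 2" if S1: "S1 \<in> ?C" for S1
    proof -
      have "\<exists>B\<in>\<A>. measure M {x. (S1 x \<in> A) \<noteq> (x \<in> B)} < r / 2" if "A \<in> F" for A
      proof -
        have "S1 -` A \<in> sets M" using measurable_sets[OF C_meas[OF S1], of A] F(2) that by auto
        from \<A>(3)[OF this, of "r / 2"] F(3) show ?thesis by simp
      qed
      then obtain g where "\<And>A. A \<in> F \<Longrightarrow> g A \<in> \<A> \<and> measure M {x. (S1 x \<in> A) \<noteq> (x \<in> g A)} < r / 2"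
        by metis
      then show ?thesis by (intro bexI[of _ "restrict g F"]) auto
    qed
    then obtain g where g: "\<And>S1. S1 \<in> ?C \<Longrightarrow> g S1 \<in> F \<rightarrow>\<^sub>E \<A>"
      "\<And>S1 A. S1 \<in> ?C \<Longrightarrow> A \<in> F \<Longrightarrow> measure M {x. (S1 x \<in> A) \<noteq> (x \<in> g S1 A)} < r / 2"
      by metis
    have q_g: "?q S1 = ?q S2" if S: "S1 \<in> ?C" "S2 \<in> ?C" and eq: "g S1 = g S2" for S1 S2
    proof (rule q_eq[OF S])
      fix A assume A: "A \<in> F"
      note [measurable] = C_meas[OF S(1)] C_meas[OF S(2)]
      have [measurable]: "A \<in> sets M" "g S2 A \<in> sets M" using A F(2) g(1)[OF S(2)] \<A>(2) by auto
      let ?X = "\<lambda>S. {x \<in> space M. (S x \<in> A) \<noteq> (x \<in> g S2 A)}"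
      have "mismatch M S1 S2 A \<le> measure M (?X S1 \<union> ?X S2)"
        unfolding mismatch_def by (intro finite_measure_mono) (auto simp del: space_M)
      also have "\<dots> \<le> measure M (?X S1) + measure M (?X S2)"
        by (intro measure_Un_le) measurable
      also have "\<dots> < r" using g(2)[OF S(1) A] g(2)[OF S(2) A] by (simp add: eq)
      finally show "mismatch M S1 S2 A < r" .
    qed
    have "countable (g ` ?C)"
      by (rule countable_subset[OF _ countable_PiE[OF F(1) \<A>(1)]]) (use g(1) in auto)
    \<comment> \<open>Choosing one element per code makes the coset a function of the code.\<close>
    then have "countable ((\<lambda>h. ?q (SOME S1. S1 \<in> ?C \<and> g S1 = h)) ` g ` ?C)" by (rule countable_image)
    moreover have "?q S1 = ?q (SOME S2. S2 \<in> ?C \<and> g S2 = g S1)" if "S1 \<in> ?C" for S1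
      using someI[of "\<lambda>S2. S2 \<in> ?C \<and> g S2 = g S1" S1] that by (intro q_g) auto
    then have "EC M T \<subseteq> (\<lambda>h. ?q (SOME S1. S1 \<in> ?C \<and> g S1 = h)) ` g ` ?C"
      unfolding EC_def by blast
    ultimately show ?thesis by (rule countable_subset[rotated])
  qed
  have C_sub: "?C \<subseteq> aut M" by (auto simp: centralizer_def)
  have top_C: "topspace (subtopology (sot M) ?C) = ?C"
    using C_sub by (auto simp: topspace_sot[OF assms(1)])
  have "openin (subtopology (sot M) ?C) {S1 \<in> ?C. ?q S1 \<in> U}" for U
  proof (subst openin_subopen, rule ballI)
    fix S0 assume "S0 \<in> {S1 \<in> ?C. ?q S1 \<in> U}"
    then have S0: "S0 \<in> ?C" "?q S0 \<in> U" by auto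
    \<comment> \<open>The factor \<open>topspace (sot M)\<close> matters when \<open>F\<close> is
      empty, since the intersection over it is then the whole type.\<close>
    define V where "V = (\<Inter>A\<in>F. {S1 \<in> aut M. mismatch M S1 S0 A < r}) \<inter> topspace (sot M)"
    have V: "openin (sot M) V"
      unfolding V_def using F S0(1) C_sub
      by (intro openin_INT openin_sot_mismatch assms(1)) auto
    have S0V: "S0 \<in> V" using S0(1) C_sub F(3) by (auto simp: V_def topspace_sot[OF assms(1)] mismatch_def)
    have sub: "V \<inter> ?C \<subseteq> {S1 \<in> ?C. ?q S1 \<in> U}"
    proof safe
      fix S1 assume "S1 \<in> V" "S1 \<in> ?C"
      then have "?q S1 = ?q S0" by (intro q_eq S0(1)) (auto simp: V_def)
      then show "?q S1 \<in> U" using S0(2) by simp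
    qed
    show "\<exists>W. openin (subtopology (sot M) ?C) W \<and> S0 \<in> W \<and> W \<subseteq> {S1 \<in> ?C. ?q S1 \<in> U}"
      using V S0V S0(1) sub by (intro exI[of _ "V \<inter> ?C"]) (auto simp: openin_subtopology)
  qed
  then show "quotient_map (subtopology (sot M) ?C) (discrete_topology (EC M T)) ?q"
    unfolding quotient_map_def top_C by (simp add: EC_def)
qed

end
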